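(* Let $F$ be a subfield of $\mathbb{R}$ and let $S \subseteq \mathbb{R}^n$ ($n\ge 1$) be an open convex subset. Let $f: S \cap F^n \to \mathbb{R}$ be a continuous function. Suppose that for every $F$-rational line segment $\ell \subseteq S$ parallel to one of the coordinate axes, the restriction of $f$ to $\ell \cap F^n$ is $F$-integral polyhedral. Then $f$ extends uniquely to a continuous function $\tilde f: S \to \mathbb{R}$ such that for each $x\in\mathbb{R}^n$ and each $i\in\{1,\dots,n\}$ the restriction of $\tilde f$ to $S\cap(x+\mathbb{R}e_i)$ is convex, and this extension $\tilde f$ is locally $F$-integral polyhedral on $S$.
   Context: $e_1,\dots,e_n$ is the standard basis of $\mathbb{R}^n$. An affine functional $\lambda(x_1,\dots,x_n)=a_1x_1+\cdots+a_nx_n+b$ on $\mathbb{R}^n$ is $F$-integral if $a_1,\dots,a_n\in\mathbb{Z}$ and $b\in F$. An $F$-rational polyhedral subset of $\mathbb{R}^n$ is an intersection of finitely many closed halfspaces $\{x:\lambda(x)\ge 0\}$ with each $\lambda$ an $F$-integral affine functional with $(a_1,\dots,a_n)\neq 0$; an $F$-rational line segment is a (bounded, closed) line segment that is an $F$-rational polyhedral subset. For any $T\subseteq\mathbb{R}^n$, a function $g:T\to\mathbb{R}$ is $F$-integral polyhedral if $g(x)=\max\{\lambda_1(x),\dots,\lambda_m(x)\}$ for all $x\in T$, for some finite list of $F$-integral affine functionals $\lambda_1,\dots,\lambda_m$ on $\mathbb{R}^n$. For $S$ convex, $g:S\to\mathbb{R}$ is locally $F$-integral polyhedral if every $x\in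 S$ has a neighborhood $U$ in $\mathbb{R}^n$ such that $g|_{U\cap S}$ is $F$-integral polyhedral. *)

theory Defs
  imports "HOL-Analysis.Analysis"
begin

definition real_subfield :: "real set \<Rightarrow> bool" where
  "real_subfield F \<longleftrightarrow>
     0 \<in> F \<and> 1 \<in> F \<and>
     (\<forall>x\<in>F. \<forall>y\<in>F. x + y \<in> F) \<and> (\<forall>x\<in>F. - x \<in> F) \<and>
     (\<forall>x\<in>F. \<forall>y\<in>F. x * y \<in> F) \<and> (\<forall>x\<in>F. x \<noteq> 0 \<longrightarrow> inverse x \<in> F)"

definition F_points :: "real set \<Rightarrow> (real ^ 'n) set" where
  "F_points F = {x. \<forall>i. x $ i \<in> F}"

definition F_integral_affine :: "real set \<Rightarrow> (real ^ 'n \<Rightarrow> real) \<Rightarrow> bool" where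
  "F_integral_affine F l \<longleftrightarrow>
     (\<exists>a b. (\<forall>i. a $ i \<in> \<int>) \<and> b \<in> F \<and> l = (\<lambda>x. a \<bullet> x + b))"

definition F_rational_halfspace :: "real set \<Rightarrow> (real ^ 'n) set \<Rightarrow> bool" where
  "F_rational_halfspace F H \<longleftrightarrow>
     (\<exists>a b. a \<noteq> 0 \<and> (\<forall>i. a $ i \<in> \<int>) \<and> b \<in> F \<and> H = {x. a \<bullet> x + b \<ge> 0})"

definition F_rational_polyhedral :: "real set \<Rightarrow> (real ^ 'n) set \<Rightarrow> bool" where
  "F_rational_polyhedral F P \<longleftrightarrow>
     (\<exists>\<H>. finite \<H> \<and> (\<forall>H\<in>\<H>. F_rational_halfspace F H) \<and> P = \<Inter>\<H>)"

text \<open>Line segments are understood to be nondegenerate.\<close>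

definition F_rational_segment :: "real set \<Rightarrow> (real ^ 'n) set \<Rightarrow> bool" where
  "F_rational_segment F L \<longleftrightarrow>
     (\<exists>p q. p \<noteq> q \<and> L = closed_segment p q) \<and> F_rational_polyhedral F L"

definition axis_line :: "real ^ 'n \<Rightarrow> 'n \<Rightarrow> (real ^ 'n) set" where
  "axis_line x i = {x + t *\<^sub>R axis i 1 | t. True}"

definition parallel_to_axis :: "(real ^ 'n) set \<Rightarrow> bool" where
  "parallel_to_axis L \<longleftrightarrow> (\<exists>x i. L \<subseteq> axis_line x i)"

text \<open>The list of functionals is required to be nonempty, since \<^const>\<open>Max\<close> is unspecified on
  the empty set.\<close>

definition F_integral_polyhedral_on ::
    "real set \<Rightarrow> (real ^ 'n) set \<Rightarrow> (real ^ 'n \<Rightarrow> real) \<Rightarrow> bool" where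
  "F_integral_polyhedral_on F T g \<longleftrightarrow>
     (\<exists>ls. ls \<noteq> [] \<and> (\<forall>l\<in>set ls. F_integral_affine F l) \<and>
           (\<forall>x\<in>T. g x = Max ((\<lambda>l. l x) ` set ls)))"

definition locally_F_integral_polyhedral_on ::
    "real set \<Rightarrow> (real ^ 'n) set \<Rightarrow> (real ^ 'n \<Rightarrow> real) \<Rightarrow> bool" where
  "locally_F_integral_polyhedral_on F S g \<longleftrightarrow>
     (\<forall>x\<in>S. \<exists>U. open U \<and> x \<in> U \<and> F_integral_polyhedral_on F (U \<inter> S) g)"

text \<open>Functions on a subset are represented by total functions, so extensions of \<open>f\<close> are to be
  compared on \<open>S\<close> only.\<close>

definition axis_convex_extension ::
    "real set \<Rightarrow> (real ^ 'n) set \<Rightarrow> (real ^ 'n \<Rightarrow> real) \<Rightarrow> (real ^ 'n \<Rightarrow> real) \<Rightarrow> bool" where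
  "axis_convex_extension F S f g \<longleftrightarrow>
     (\<forall>x \<in> S \<inter> F_points F. g x = f x) \<and>
     continuous_on S g \<and>
     (\<forall>x i. convex_on (S \<inter> axis_line x i) g)"

end

theory Submission imports Defs begin

text \<open>
  On an axis-parallel segment with endpoints in \<open>F\<^sup>n\<close>, \<open>f\<close> has an integer subgradient at every point
  of \<open>F\<^sup>n\<close>. Hence \<open>f\<close> is convex along axes, so locally bounded and locally Lipschitz, and extends to
  a continuous \<open>g\<close> on \<open>S\<close>. The main point is that \<open>g\<close> is jointly convex. Where a paraboloid touches
  \<open>g\<close> from above, the axial slopes of \<open>g\<close> nearby are integers confined to intervals of length less
  than \<open>1\<close>, so they are constant and \<open>g\<close> is affine there; an affine function cannot touch from below
  a paraboloid that is strictly concave in some direction, and this excludes any failure of convexity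
  (an argument in the style of viscosity solutions). Points of contact with paraboloids are dense, and
  by convexity the affine pieces at these points are global supports of \<open>g\<close>. Near a given point they
  have bounded integer gradients, so there are finitely many of them, and \<open>g\<close> is their maximum.
\<close>

section \<open>Subfields of the reals and density of their points\<close>

lemma real_subfield_add: "real_subfield F \<Longrightarrow> x \<in> F \<Longrightarrow> y \<in> F \<Longrightarrow> x + y \<in> F"
  and real_subfield_uminus: "real_subfield F \<Longrightarrow> x \<in> F \<Longrightarrow> - x \<in> F"
  and real_subfield_mult: "real_subfield F \<Longrightarrow> x \<in> F \<Longrightarrow> y \<in> F \<Longrightarrow> x * y \<in> F"
  by (auto simp: real_subfield_def)

lemma real_subfield_diff: "real_subfield F \<Longrightarrow> x \<in> F \<Longrightarrow> y \<in> F \<Longrightarrow> x - y \<in> F"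
  using real_subfield_add[of F x "- y"] real_subfield_uminus by auto

lemma real_subfield_of_int:
  assumes "real_subfield F" shows "of_int k \<in> F"
proof -
  have n: "of_nat n \<in> F" for n
    using assms by (induction n) (auto simp: real_subfield_def)
  show ?thesis
    using n real_subfield_uminus[OF assms] by (cases k rule: int_cases2) auto
qed

lemma real_subfield_Ints: "real_subfield F \<Longrightarrow> x \<in> \<int> \<Longrightarrow> x \<in> F"
  by (auto elim: Ints_cases intro: real_subfield_of_int)

lemma real_subfield_Rats:
  assumes "real_subfield F" "x \<in> \<rat>" shows "x \<in> F"
proof -
  obtain a b where "b > 0" "x = of_int a / of_int b"
    using Rats_cases'[OF assms(2)] by metis
  then show ?thesis
    using assms(1) real_subfield_of_int[OF assms(1)]
    by (auto simp: real_subfield_def divide_inverse)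
qed

lemma real_subfield_sum:
  assumes "real_subfield F" "\<And>i. i \<in> I \<Longrightarrow> h i \<in> F" shows "sum h I \<in> F"
proof -
  have "0 \<in> F" using assms(1) by (simp add: real_subfield_def)
  with assms(2) show ?thesis
    by (induction I rule: infinite_finite_induct) (auto intro: real_subfield_add[OF assms(1)])
qed

lemma real_subfield_dense:
  fixes U :: "real set"
  assumes "real_subfield F" "open U" "x \<in> U" shows "\<exists>q\<in>U. q \<in> F"
proof -
  obtain e where "e > 0" and e: "ball x e \<subseteq> U" using assms openE by metis
  then obtain q where "q \<in> \<rat>" "x < q" "q < x + e"
    using Rats_dense_in_real[of x "x + e"] by auto
  then have "q \<in> ball x e" by (auto simp: dist_real_def)
  then show ?thesis using e \<open>q \<in> \<rat>\<close> real_subfield_Rats[OF assms(1)] by blast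
qed

lemma F_points_dense:
  fixes U :: "(real ^ 'n) set"
  assumes "real_subfield F" "open U" "x \<in> U" shows "\<exists>q\<in>U. q \<in> F_points F"
proof -
  obtain A where A: "\<And>i. open (A i)" "\<And>i. x $ i \<in> A i" "\<And>y. (\<forall>i. y $ i \<in> A i) \<Longrightarrow> y \<in> U"
    using assms(2,3) unfolding open_vec_def by metis
  then have "\<forall>i. \<exists>q\<in>A i. q \<in> F"
    using real_subfield_dense[OF assms(1)] by meson
  then obtain q where "\<And>i. q i \<in> A i \<and> q i \<in> F" by metis
  then show ?thesis
    using A(3)[of "\<chi> i. q i"] by (intro bexI[of _ "\<chi> i. q i"]) (auto simp: F_points_def)
qed

text \<open>The set where the two functions differ is open, so density would put a point of
  \<open>F_points F\<close> in it. This serves for gluing local extensions, for recognising affine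
  pieces, and for uniqueness.\<close>

lemma continuous_eq_on_F_points:
  fixes g h :: "real ^ 'n \<Rightarrow> real"
  assumes F: "real_subfield F" and "open U" and g: "continuous_on U g" and h: "continuous_on U h"
    and eq: "\<And>q. q \<in> U \<Longrightarrow> q \<in> F_points F \<Longrightarrow> g q = h q" and "x \<in> U"
  shows "g x = h x"
proof (rule ccontr)
  assume ne: "g x \<noteq> h x"
  have "open (U \<inter> (\<lambda>x. g x - h x) -` (- {0}))"
    by (rule continuous_open_preimage) (auto intro!: continuous_intros g h \<open>open U\<close>)
  then show False
    using F_points_dense[OF F, of "U \<inter> (\<lambda>x. g x - h x) -` (- {0})" x] ne \<open>x \<in> U\<close> eq by auto
qed

section \<open>Boxes and coordinatewise increments\<close>

lemma axis_nth [simp]: "axis i a $ j = (if j = i then a else 0)"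
  by (simp add: axis_def)

lemma F_points_shift:
  "real_subfield F \<Longrightarrow> q \<in> F_points F \<Longrightarrow> s \<in> F \<Longrightarrow> q + s *\<^sub>R axis i 1 \<in> F_points F"
  by (auto simp: F_points_def real_subfield_add)

lemma norm_le_of_components:
  fixes v :: "real ^ 'n"
  assumes "\<And>i. \<bar>v $ i\<bar> \<le> r" shows "norm v \<le> real CARD('n) * r"
proof -
  have "norm v \<le> (\<Sum>i\<in>UNIV. \<bar>v $ i\<bar>)" by (rule norm_le_l1_cart)
  also have "\<dots> \<le> (\<Sum>i\<in>(UNIV::'n set). r)" by (rule sum_mono) (use assms in auto)
  finally show ?thesis by simp
qed

text \<open>Centre and radius come from \<open>F\<close>, so axial shifts by \<open>r\<close> and
  reflection in the centre preserve \<open>F_points F\<close>. The doubled radius leaves room for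
  axial steps of length \<open>r\<close> from the inner box.\<close>

lemma F_centred_box:
  fixes x :: "real ^ 'n"
  assumes F: "real_subfield F" and "open S" "x \<in> S"
  obtains c r where "c \<in> F_points F" "r \<in> F" "r > 0" "\<And>i. \<bar>x $ i - c $ i\<bar> < r"
    "\<And>w. (\<And>i. \<bar>w $ i - c $ i\<bar> \<le> 2 * r) \<Longrightarrow> w \<in> S"
proof -
  obtain e where "e > 0" and e: "ball x e \<subseteq> S" using assms openE by metis
  define N where "N = real CARD('n)"
  have N: "N > 0" by (simp add: N_def)
  \<comment> \<open>The 3 accounts for \<open>r\<close> between \<open>x\<close> and
    \<open>c\<close> plus \<open>2 * r\<close> between \<open>c\<close> and \<open>w\<close>;
    \<open>N\<close> turns a bound on components into one on the norm.\<close>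
  obtain r where r: "r \<in> \<rat>" "0 < r" "r < e / (3 * N)"
    using Rats_dense_in_real[of 0 "e / (3 * N)"] N \<open>e > 0\<close> by auto
  obtain c where c: "c \<in> ball x r" "c \<in> F_points F"
    using F_points_dense[OF F, of "ball x r" x] r by auto
  have xc: "\<bar>x $ i - c $ i\<bar> < r" for i
    using c(1) component_le_norm_cart[of "x - c" i] by (auto simp: dist_norm)
  have "w \<in> S" if w: "\<And>i. \<bar>w $ i - c $ i\<bar> \<le> 2 * r" for w
  proof -
    have "\<bar>(w - x) $ i\<bar> \<le> 3 * r" for i using w[of i] xc[of i] by auto
    then have "norm (w - x) \<le> N * (3 * r)" unfolding N_def by (rule norm_le_of_components)
    also have "\<dots> < e" using r(3) N by (auto simp: field_simps)
    finally show ?thesis using e by (auto simp: dist_norm norm_minus_commute)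
  qed
  then show ?thesis using that c(2) r xc real_subfield_Rats[OF F] by blast
qed

text \<open>Pass from \<open>w\<close> to \<open>w'\<close> one coordinate at a time and add up the
  steps. The sets \<open>A i\<close> are arbitrary so that they can be open intervals intersected
  with \<open>F\<close>; \<open>a = 0\<close> yields a Lipschitz bound, \<open>L = 0\<close> exact
  affineness.\<close>

lemma coordinatewise_increment_bound:
  fixes f :: "real ^ 'n \<Rightarrow> real"
  assumes step: "\<And>w j s. \<lbrakk>\<forall>i. w $ i \<in> A i; w $ j + s \<in> A j\<rbrakk> \<Longrightarrow>
      \<bar>f (w + s *\<^sub>R axis j 1) - f w - a $ j * s\<bar> \<le> L * \<bar>s\<bar>"
    and w: "\<forall>i. w $ i \<in> A i" and w': "\<forall>i. w' $ i \<in> A i"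
  shows "\<bar>f w' - f w - a \<bullet> (w' - w)\<bar> \<le> L * (\<Sum>i\<in>UNIV. \<bar>w' $ i - w $ i\<bar>)"
proof -
  define z where "z I = (\<chi> i. if i \<in> I then w' $ i else w $ i)" for I :: "'n set"
  have "\<bar>f (z I) - f w - (\<Sum>i\<in>I. a $ i * (w' $ i - w $ i))\<bar> \<le> L * (\<Sum>i\<in>I. \<bar>w' $ i - w $ i\<bar>)"
    if "finite I" for I
    using that
  proof (induction I rule: finite_induct)
    case empty
    have "z {} = w" by (simp add: z_def vec_eq_iff)
    then show ?case by simp
  next
    case (insert j I)
    have eq: "z (insert j I) = z I + (w' $ j - w $ j) *\<^sub>R axis j 1"
      using insert by (auto simp: z_def vec_eq_iff)
    have "\<bar>f (z (insert j I)) - f (z I) - a $ j * (w' $ j - w $ j)\<bar> \<le> L * \<bar>w' $ j - w $ j\<bar>"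
      unfolding eq by (rule step) (use w w' insert in \<open>auto simp: z_def\<close>)
    with insert show ?case by (simp add: algebra_simps)
  qed
  from this[of UNIV] have "\<bar>f (z UNIV) - f w - (\<Sum>i\<in>UNIV. a $ i * (w' $ i - w $ i))\<bar>
      \<le> L * (\<Sum>i\<in>UNIV. \<bar>w' $ i - w $ i\<bar>)" by simp
  moreover have "z UNIV = w'" by (simp add: z_def vec_eq_iff)
  ultimately show ?thesis by (simp add: inner_vec_def)
qed

lemma finite_vec_of_components:
  fixes A :: "'n::finite \<Rightarrow> 'a set"
  assumes "\<And>i. finite (A i)" shows "finite {w :: 'a ^ 'n. \<forall>i. w $ i \<in> A i}"
proof (rule finite_subset)
  show "{w. \<forall>i. w $ i \<in> A i} \<subseteq> vec_lambda ` (PiE UNIV A)"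
  proof
    fix w assume "w \<in> {w. \<forall>i. w $ i \<in> A i}"
    then show "w \<in> vec_lambda ` (PiE UNIV A)"
      by (intro image_eqI[of _ _ "\<lambda>i. w $ i"]) (auto simp: vec_eq_iff)
  qed
qed (use assms in \<open>auto intro!: finite_PiE\<close>)

section \<open>Functions with integer axial subgradients: local bounds and continuous
  extension\<close>

text \<open>This isolates what the polyhedral hypothesis supplies: values in \<open>F\<close>, and
  along each axial segment a supporting line of integer slope at each of its points in
  \<open>F_points F\<close>. The slope may depend on the segment, and \<open>q\<close> may be an
  endpoint.\<close>

locale integer_subgradients =
  fixes F :: "real set" and S :: "(real ^ 'n) set" and f :: "real ^ 'n \<Rightarrow> real"
  assumes F: "real_subfield F" and open_S: "open S" and convex_S: "convex S"
    and value_in_F: "\<And>q. q \<in> S \<Longrightarrow> q \<in> F_points F \<Longrightarrow> f q \<in> F"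
    and subgradient: "\<And>q i a b. \<lbrakk>q \<in> F_points F; a \<in> F; b \<in> F; a \<le> 0; 0 \<le> b; a < b;
      q + a *\<^sub>R axis i 1 \<in> S; q + b *\<^sub>R axis i 1 \<in> S\<rbrakk> \<Longrightarrow>
      \<exists>m\<in>\<int>. \<forall>s\<in>F. a \<le> s \<and> s \<le> b \<longrightarrow> f q + m * s \<le> f (q + s *\<^sub>R axis i 1)"
begin

lemma F_simps [simp]: "0 \<in> F" "1 \<in> F" "numeral k \<in> F"
  using F real_subfield_of_int[OF F, of "numeral k"] by (auto simp: real_subfield_def)

lemma F_closed [intro]: "x \<in> F \<Longrightarrow> y \<in> F \<Longrightarrow> x + y \<in> F" "x \<in> F \<Longrightarrow> y \<in> F \<Longrightarrow> x - y \<in> F"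
    "x \<in> F \<Longrightarrow> y \<in> F \<Longrightarrow> x * y \<in> F" "x \<in> F \<Longrightarrow> - x \<in> F"
  by (simp_all add: real_subfield_add[OF F] real_subfield_diff[OF F] real_subfield_mult[OF F]
      real_subfield_uminus[OF F])

text \<open>Evaluating the supporting line at both ends and weighting by \<open>b\<close> and
  \<open>- a\<close> cancels its slope. The form without division also covers
  \<open>a = b = 0\<close>.\<close>

lemma jensen_F:
  assumes q: "q \<in> F_points F" and ab: "a \<in> F" "b \<in> F" "a \<le> 0" "0 \<le> b"
    and S: "q + a *\<^sub>R axis i 1 \<in> S" "q + b *\<^sub>R axis i 1 \<in> S"
  shows "(b - a) * f q \<le> b * f (q + a *\<^sub>R axis i 1) - a * f (q + b *\<^sub>R axis i 1)"
proof (cases "a = b")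
  case False
  then obtain m where m: "\<And>s. s \<in> F \<Longrightarrow> a \<le> s \<Longrightarrow> s \<le> b \<Longrightarrow> f q + m * s \<le> f (q + s *\<^sub>R axis i 1)"
    using subgradient[OF q ab(1-4) _ S] ab by force
  have "b * (f q + m * a) \<le> b * f (q + a *\<^sub>R axis i 1)"
    using m[of a] ab by (intro mult_left_mono) auto
  moreover have "(- a) * (f q + m * b) \<le> (- a) * f (q + b *\<^sub>R axis i 1)"
    using m[of b] ab by (intro mult_left_mono) auto
  ultimately show ?thesis by (simp add: algebra_simps)
qed (use ab in auto)

text \<open>Axiswise convexity bounds \<open>f\<close> above by its values at the vertices of the box, and then, by
  reflection in the centre one coordinate at a time, also below.\<close>

lemma bounded_above_on_box:
  assumes c: "c \<in> F_points F" and R: "R \<in> F" "R > 0"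
    and box: "\<And>w. (\<And>i. \<bar>w $ i - c $ i\<bar> \<le> R) \<Longrightarrow> w \<in> S"
  shows "\<exists>M. \<forall>w\<in>F_points F. (\<forall>i. \<bar>w $ i - c $ i\<bar> \<le> R) \<longrightarrow> f w \<le> M"
proof -
  \<comment> \<open>Coordinates in \<open>I\<close> range over the whole interval, the others sit at
    its ends. \<open>I = {}\<close> leaves the finitely many vertices, and freeing a further
    coordinate keeps the same \<open>M\<close>.\<close>
  have "\<exists>M. \<forall>w\<in>F_points F. (\<forall>i\<in>I. \<bar>w $ i - c $ i\<bar> \<le> R) \<and> (\<forall>i\<in>-I. w $ i \<in> {c $ i - R, c $ i + R})
      \<longrightarrow> f w \<le> M" if "finite I" for I
    using that
  proof (induction I rule: finite_induct)
    case empty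
    define V where "V = {w. \<forall>i. w $ i \<in> {c $ i - R, c $ i + R}}"
    have fin: "finite (f ` V)"
      unfolding V_def by (intro finite_imageI finite_vec_of_components) auto
    have "f w \<le> Max (f ` V)" if "\<forall>i\<in>-{}. w $ i \<in> {c $ i - R, c $ i + R}" for w
      using that fin by (intro Max_ge) (auto simp: V_def)
    then show ?case by blast
  next
    case (insert j I)
    then obtain M where M: "\<And>w. w \<in> F_points F \<Longrightarrow> \<forall>i\<in>I. \<bar>w $ i - c $ i\<bar> \<le> R \<Longrightarrow>
        \<forall>i\<in>-I. w $ i \<in> {c $ i - R, c $ i + R} \<Longrightarrow> f w \<le> M" by blast
    have "f w \<le> M" if w: "w \<in> F_points F" "\<forall>i\<in>insert j I. \<bar>w $ i - c $ i\<bar> \<le> R"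
        "\<forall>i\<in>-insert j I. w $ i \<in> {c $ i - R, c $ i + R}" for w
    proof -
      define a b where "a = c $ j - R - w $ j" and "b = c $ j + R - w $ j"
      have ab: "a \<in> F" "b \<in> F" "a \<le> 0" "0 \<le> b" "b - a > 0"
        using c w R by (auto simp: a_def b_def F_points_def abs_le_iff)
      have *: "\<bar>w $ i - c $ i\<bar> \<le> R" for i
        using w R by (cases "i \<in> insert j I") force+
      have box': "w + s *\<^sub>R axis j 1 \<in> S" if "s \<in> {a, b}" for s
        using * R that by (intro box) (auto simp: a_def b_def)
      have "f (w + s *\<^sub>R axis j 1) \<le> M" if "s \<in> {a, b}" for s
      proof (rule M)
        show "w + s *\<^sub>R axis j 1 \<in> F_points F"
          using that ab by (intro F_points_shift[OF F w(1)]) auto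
      qed (use w that insert.hyps in \<open>auto simp: a_def b_def\<close>)
      then have "b * f (w + a *\<^sub>R axis j 1) \<le> b * M" "(-a) * f (w + b *\<^sub>R axis j 1) \<le> (-a) * M"
        using ab by (intro mult_left_mono; simp)+
      with jensen_F[OF w(1) ab(1-4) box' box'] have "(b - a) * f w \<le> (b - a) * M"
        by (simp add: algebra_simps)
      with ab(5) show ?thesis by simp
    qed
    then show ?case by blast
  qed
  from this[of UNIV] show ?thesis by auto
qed

lemma bounded_on_box:
  assumes c: "c \<in> F_points F" and R: "R \<in> F" "R > 0"
    and box: "\<And>w. (\<And>i. \<bar>w $ i - c $ i\<bar> \<le> R) \<Longrightarrow> w \<in> S"
  shows "\<exists>M. \<forall>w\<in>F_points F. (\<forall>i. \<bar>w $ i - c $ i\<bar> \<le> R) \<longrightarrow> \<bar>f w\<bar> \<le> M"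
proof -
  obtain M where M: "\<And>w. w \<in> F_points F \<Longrightarrow> (\<And>i. \<bar>w $ i - c $ i\<bar> \<le> R) \<Longrightarrow> f w \<le> M"
    using bounded_above_on_box[OF assms] by blast
  \<comment> \<open>Here the coordinates outside \<open>I\<close> sit at the centre; each coordinate
    freed replaces the lower bound \<open>m\<close> by \<open>2 * m - M\<close>.\<close>
  have "\<exists>m. \<forall>w\<in>F_points F. (\<forall>i\<in>I. \<bar>w $ i - c $ i\<bar> \<le> R) \<and> (\<forall>i\<in>-I. w $ i = c $ i) \<longrightarrow> m \<le> f w"
    if "finite I" for I
    using that
  proof (induction I rule: finite_induct)
    case empty
    then show ?case by (auto simp flip: vec_eq_iff)
  next
    case (insert j I)
    then obtain m where m: "\<And>w. w \<in> F_points F \<Longrightarrow> \<forall>i\<in>I. \<bar>w $ i - c $ i\<bar> \<le> R \<Longrightarrow>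
        \<forall>i\<in>-I. w $ i = c $ i \<Longrightarrow> m \<le> f w" by blast
    have "2 * m - M \<le> f w" if w: "w \<in> F_points F" "\<forall>i\<in>insert j I. \<bar>w $ i - c $ i\<bar> \<le> R"
        "\<forall>i\<in>-insert j I. w $ i = c $ i" for w
    proof -
      have *: "\<bar>w $ i - c $ i\<bar> \<le> R" for i
        using w R by (cases "i \<in> insert j I") auto
      define d where "d = \<bar>w $ j - c $ j\<bar>"
      \<comment> \<open>\<open>z\<close> is the midpoint of \<open>w\<close> and its mirror image in
        coordinate \<open>j\<close>. At the image \<open>f\<close> is at most \<open>M\<close>, so
        convexity gives \<open>2 * f z \<le> f w + M\<close>.\<close>
      define z where "z = w + (c $ j - w $ j) *\<^sub>R axis j 1"
      have z: "z \<in> F_points F" unfolding z_def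
        using c w by (intro F_points_shift[OF F w(1)]) (auto simp: F_points_def)
      have d: "d \<in> F" "- d \<in> F" "0 \<le> d"
        using c w by (auto simp: d_def F_points_def abs_if)
      have zs: "\<bar>(z + s *\<^sub>R axis j 1) $ i - c $ i\<bar> \<le> R" if "s \<in> {d, - d}" for s i
        using * that by (auto simp: z_def d_def)
      have zS: "z + s *\<^sub>R axis j 1 \<in> S" if "s \<in> {d, - d}" for s
        using zs[OF that] by (rule box)
      have J: "2 * d * f z \<le> d * (f (z + d *\<^sub>R axis j 1) + f (z + (- d) *\<^sub>R axis j 1))"
        using jensen_F[OF z d(2,1) _ _ zS zS] d by (simp add: algebra_simps)
      have mz: "m \<le> f z"
        using m[OF z] w insert.hyps by (auto simp: z_def)
      show ?thesis
      proof (cases "d = 0")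
        case True
        then have "z = w" by (auto simp: z_def d_def vec_eq_iff)
        with mz M[OF w(1) *] show ?thesis by simp
      next
        case False
        then have "2 * f z \<le> f (z + d *\<^sub>R axis j 1) + f (z + (- d) *\<^sub>R axis j 1)"
          using J d by (simp add: mult.assoc mult.left_commute[of 2 d])
        moreover have "f (z + s *\<^sub>R axis j 1) \<le> M" if "s \<in> {d, - d}" for s
          using zs[OF that] that d by (intro M F_points_shift[OF F z]) auto
        moreover have "w = z + d *\<^sub>R axis j 1 \<or> w = z + (- d) *\<^sub>R axis j 1"
          by (auto simp: z_def d_def vec_eq_iff abs_if)
        ultimately show ?thesis using mz by (smt (verit) insert_iff)
      qed
    qed
    then show ?case by blast
  qed
  from this[of UNIV] obtain m where "\<And>w. w \<in> F_points F \<Longrightarrow> (\<And>i. \<bar>w $ i - c $ i\<bar> \<le> R) \<Longrightarrow> m \<le> f w"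
    by auto
  with M have "\<bar>f w\<bar> \<le> max \<bar>M\<bar> \<bar>m\<bar>" if "w \<in> F_points F" "\<And>i. \<bar>w $ i - c $ i\<bar> \<le> R" for w
    using that by (smt (verit))
  then show ?thesis by blast
qed

text \<open>A supporting line at \<open>w\<close> starts at height at least \<open>- M\<close> and
  is at most \<open>M\<close> after axial steps \<open>r\<close> and \<open>- r\<close>, which stay
  in the doubled box; so its slope is at most \<open>2 * M / r\<close> in absolute value.\<close>

lemma locally_lipschitz:
  assumes "x \<in> S"
  obtains U L where "open U" "x \<in> U" "U \<subseteq> S"
    "\<And>w w'. \<lbrakk>w \<in> U; w' \<in> U; w \<in> F_points F; w' \<in> F_points F\<rbrakk> \<Longrightarrow> \<bar>f w' - f w\<bar> \<le> L * norm (w' - w)"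
proof -
  obtain c r where c: "c \<in> F_points F" and r: "r \<in> F" "r > 0"
    and xc: "\<And>i. \<bar>x $ i - c $ i\<bar> < r"
    and box: "\<And>w. (\<And>i. \<bar>w $ i - c $ i\<bar> \<le> 2 * r) \<Longrightarrow> w \<in> S"
    using F_centred_box[OF F open_S assms] by metis
  obtain M where M: "\<And>w. w \<in> F_points F \<Longrightarrow> (\<And>i. \<bar>w $ i - c $ i\<bar> \<le> 2 * r) \<Longrightarrow> \<bar>f w\<bar> \<le> M"
    using bounded_on_box[OF c, of "2 * r", OF F_closed(3) _ box] r by auto
  define L where "L = 2 * M / r"
  define U where "U = {w. \<forall>i. w $ i \<in> {c $ i - r <..< c $ i + r}}"
  have U: "U = box (\<chi> i. c $ i - r) (\<chi> i. c $ i + r)"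
    by (auto simp: U_def mem_box_cart)
  have one: "f w - L * \<bar>s\<bar> \<le> f (w + s *\<^sub>R axis j 1)"
    if w: "w \<in> F_points F" "w \<in> U" "s \<in> F" "w + s *\<^sub>R axis j 1 \<in> U" for w s j
  proof -
    have *: "\<bar>w $ i - c $ i\<bar> < r" for i
      using w(2) by (auto simp: U_def abs_less_iff dest!: spec[of _ i])
    have s: "\<bar>w $ j + s - c $ j\<bar> < r"
      using w(4) by (auto simp: U_def abs_less_iff dest: spec[of _ j])
    \<comment> \<open>The interval from \<open>a\<close> to \<open>b\<close> contains
      \<open>s\<close> as well as \<open>r\<close> and \<open>- r\<close>, so a single slope serves
      all three increments.\<close>
    define a b where "a = min s (- r)" and "b = max s r"
    have near: "\<bar>(w + t *\<^sub>R axis j 1) $ i - c $ i\<bar> \<le> 2 * r" if "t \<in> {a, b, r, - r}" for t i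
      using *[of i] *[of j] s that r by (auto simp: a_def b_def min_def max_def)
    have ab: "a \<in> F" "b \<in> F" "a \<le> 0" "0 \<le> b" "a < b"
      using w(3) r by (auto simp: a_def b_def min_def max_def)
    have "w + a *\<^sub>R axis j 1 \<in> S" "w + b *\<^sub>R axis j 1 \<in> S"
      by (intro box near; simp)+
    then obtain m where m: "\<And>t. t \<in> F \<Longrightarrow> a \<le> t \<Longrightarrow> t \<le> b \<Longrightarrow> f w + m * t \<le> f (w + t *\<^sub>R axis j 1)"
      using subgradient[OF w(1) ab] by blast
    have up: "\<bar>f (w + t *\<^sub>R axis j 1)\<bar> \<le> M" if "t \<in> {r, - r}" for t
      using near that w r by (intro M F_points_shift[OF F]) auto
    have "\<bar>f w\<bar> \<le> M"
    proof (intro M w)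
      show "\<bar>w $ i - c $ i\<bar> \<le> 2 * r" for i using *[of i] r by linarith
    qed
    moreover have "f w + m * t \<le> M" if "t \<in> {r, - r}" for t
    proof -
      have "t \<in> F" "a \<le> t" "t \<le> b" using that r by (auto simp: a_def b_def)
      from m[OF this] up[OF that] show ?thesis by linarith
    qed
    from this[of r] this[of "- r"] have "f w + m * r \<le> M" "f w - m * r \<le> M" by auto
    ultimately have "\<bar>m * r\<bar> \<le> 2 * M" by linarith
    then have "\<bar>m\<bar> * r \<le> 2 * M" using r by (simp add: abs_mult)
    then have "\<bar>m\<bar> \<le> L" using r by (simp add: L_def field_simps)
    then have "\<bar>m * s\<bar> \<le> L * \<bar>s\<bar>" by (simp add: abs_mult mult_right_mono)
    moreover have "f w + m * s \<le> f (w + s *\<^sub>R axis j 1)"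
      by (rule m) (use w in \<open>auto simp: a_def b_def\<close>)
    ultimately show ?thesis by linarith
  qed
  have L: "L \<ge> 0" using M[OF c] r by (force simp: L_def)
  have "\<bar>f w' - f w\<bar> \<le> (L * CARD('n)) * norm (w' - w)"
    if w: "w \<in> U" "w' \<in> U" "w \<in> F_points F" "w' \<in> F_points F" for w w'
  proof -
    have "\<bar>f w' - f w - 0 \<bullet> (w' - w)\<bar> \<le> L * (\<Sum>i\<in>UNIV. \<bar>w' $ i - w $ i\<bar>)"
    proof (rule coordinatewise_increment_bound)
      fix w :: "real ^ 'n" and j s
      assume w: "\<forall>i. w $ i \<in> {c $ i - r <..< c $ i + r} \<inter> F"
        and ws: "w $ j + s \<in> {c $ j - r <..< c $ j + r} \<inter> F"
      have s: "s \<in> F" using w ws F_closed(2)[of "w $ j + s" "w $ j"] by auto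
      have F': "w \<in> F_points F" "w + s *\<^sub>R axis j 1 \<in> F_points F"
        using w s by (auto simp: F_points_def)
      have U': "w \<in> U" "w + s *\<^sub>R axis j 1 \<in> U" using w ws by (auto simp: U_def)
      have "f w - L * \<bar>s\<bar> \<le> f (w + s *\<^sub>R axis j 1)"
        using one[OF F'(1) U'(1) s U'(2)] .
      moreover have "f (w + s *\<^sub>R axis j 1) - L * \<bar>- s\<bar> \<le> f w"
        using one[OF F'(2) U'(2), of "- s" j] s U'(1) by auto
      ultimately show "\<bar>f (w + s *\<^sub>R axis j 1) - f w - 0 $ j * s\<bar> \<le> L * \<bar>s\<bar>" by auto
    qed (use w in \<open>auto simp: U_def F_points_def\<close>)
    also have "\<dots> \<le> L * (\<Sum>i\<in>(UNIV::'n set). norm (w' - w))"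
      using component_le_norm_cart[of "w' - w"] L by (intro mult_left_mono sum_mono) auto
    finally show ?thesis by simp
  qed
  moreover have "x \<in> U" using xc by (auto simp: U_def abs_less_iff algebra_simps)
  moreover have "U \<subseteq> S"
  proof (intro subsetI box)
    show "\<bar>w $ i - c $ i\<bar> \<le> 2 * r" if "w \<in> U" for w i
      using that r by (auto simp: U_def abs_le_iff dest!: spec[of _ i])
  qed
  ultimately show ?thesis using that[of U] open_box U by metis
qed

text \<open>The Lipschitz bound is only local, so \<open>f\<close> is extended near each point by
  uniform continuity. Local extensions agree on overlaps because they equal \<open>f\<close> on a
  dense subset.\<close>

lemma continuous_extension_exists:
  obtains g where "continuous_on S g" "\<And>q. q \<in> S \<Longrightarrow> q \<in> F_points F \<Longrightarrow> g q = f q"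
proof -
  have "\<exists>U h. open U \<and> x \<in> U \<and> U \<subseteq> S \<and> continuous_on U h \<and> (\<forall>q\<in>U \<inter> F_points F. h q = f q)"
    if "x \<in> S" for x
  proof -
    obtain U L where U: "open U" "x \<in> U" "U \<subseteq> S"
      and L: "\<And>w w'. \<lbrakk>w \<in> U; w' \<in> U; w \<in> F_points F; w' \<in> F_points F\<rbrakk> \<Longrightarrow> \<bar>f w' - f w\<bar> \<le> L * norm (w' - w)"
      using locally_lipschitz[OF \<open>x \<in> S\<close>] by metis
    have "\<bar>L\<bar>-lipschitz_on (U \<inter> F_points F) f"
    proof (rule lipschitz_onI)
      fix w w' assume "w \<in> U \<inter> F_points F" "w' \<in> U \<inter> F_points F"
      then have "\<bar>f w - f w'\<bar> \<le> L * norm (w - w')" by (intro L) auto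
      also have "\<dots> \<le> \<bar>L\<bar> * norm (w - w')" by (intro mult_right_mono) auto
      finally show "dist (f w) (f w') \<le> \<bar>L\<bar> * dist w w'" by (simp add: dist_norm)
    qed simp
    then obtain h where h: "uniformly_continuous_on (closure (U \<inter> F_points F)) h"
        "\<And>q. q \<in> U \<inter> F_points F \<Longrightarrow> f q = h q"
      using uniformly_continuous_on_extension_on_closure lipschitz_on_uniformly_continuous by metis
    have "U \<subseteq> closure (U \<inter> F_points F)"
    proof
      fix y assume "y \<in> U"
      have "\<exists>q\<in>U \<inter> F_points F. dist q y < e" if "e > 0" for e
        using F_points_dense[OF F, of "U \<inter> ball y e" y] U \<open>y \<in> U\<close> that
        by (auto simp: dist_commute open_Int)
      then show "y \<in> closure (U \<inter> F_points F)" by (simp add: closure_approachable)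
    qed
    then have "continuous_on U h"
      using h(1) continuous_on_subset uniformly_continuous_imp_continuous by blast
    then show ?thesis using U h(2) by force
  qed
  then obtain U h where Uh: "\<And>x. x \<in> S \<Longrightarrow> open (U x)" "\<And>x. x \<in> S \<Longrightarrow> x \<in> U x"
      "\<And>x. x \<in> S \<Longrightarrow> U x \<subseteq> S" "\<And>x. x \<in> S \<Longrightarrow> continuous_on (U x) (h x)"
      "\<And>x q. x \<in> S \<Longrightarrow> q \<in> U x \<inter> F_points F \<Longrightarrow> h x q = f q"
    by metis
  define g where "g x = h x x" for x
  have g: "g y = h x y" if "x \<in> S" "y \<in> U x" for x y
  proof -
    have "y \<in> S" using Uh that by blast
    have "h y y = h x y"
    proof (rule continuous_eq_on_F_points[OF F, where U = "U x \<inter> U y" and g = "h y" and h = "h x"])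
      show "open (U x \<inter> U y)" using Uh that \<open>y \<in> S\<close> by auto
      show "continuous_on (U x \<inter> U y) (h x)" "continuous_on (U x \<inter> U y) (h y)"
        using Uh(4) that \<open>y \<in> S\<close> continuous_on_subset by blast+
    qed (use Uh that \<open>y \<in> S\<close> in auto)
    then show ?thesis by (simp add: g_def)
  qed
  have "continuous_on (\<Union>x\<in>S. U x) g"
  proof (rule continuous_on_open_UN)
    show "continuous_on (U x) g" if "x \<in> S" for x
      using Uh(4)[OF that] g[OF that] continuous_on_cong by metis
  qed (use Uh in auto)
  moreover have "(\<Union>x\<in>S. U x) = S" using Uh by blast
  moreover have "g q = f q" if "q \<in> S" "q \<in> F_points F" for q
    using Uh that by (simp add: g_def)
  ultimately show ?thesis using that by metis
qed

end

section \<open>Axial convexity of the extension and its affineness at points of contact\<close>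

locale integer_subgradients_extension = integer_subgradients F S f
  for F :: "real set" and S :: "(real ^ 'n) set" and f :: "real ^ 'n \<Rightarrow> real" +
  fixes g :: "real ^ 'n \<Rightarrow> real"
  assumes continuous: "continuous_on S g"
    and extends: "\<And>q. q \<in> S \<Longrightarrow> q \<in> F_points F \<Longrightarrow> g q = f q"
begin

text \<open>Strict failure is an open condition on \<open>(z, a, b)\<close>, so it would persist for
  some triple taken from \<open>F_points F\<close> and \<open>F\<close>, against
  \<open>jensen_F\<close>.\<close>

lemma jensen:
  assumes z: "z \<in> S" and ab: "a \<le> 0" "0 \<le> b"
    and S: "z + a *\<^sub>R axis i 1 \<in> S" "z + b *\<^sub>R axis i 1 \<in> S"
  shows "(b - a) * g z \<le> b * g (z + a *\<^sub>R axis i 1) - a * g (z + b *\<^sub>R axis i 1)"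
proof (rule ccontr)
  define e where "e = (axis i 1 :: real ^ 'n)"
  define \<Phi> where "\<Phi> = (\<lambda>(z, a, b). (b - a) * g z - b * g (z + a *\<^sub>R e) + a * g (z + b *\<^sub>R e))"
  define D where "D = {(z, a, b). z \<in> S \<and> z + a *\<^sub>R e \<in> S \<and> z + b *\<^sub>R e \<in> S \<and> a < 0 \<and> 0 < b}"
  assume "\<not> ?thesis"
  then have pos: "\<Phi> (z, a, b) > 0" by (simp add: \<Phi>_def e_def)
  \<comment> \<open>For \<open>a = 0\<close> or \<open>b = 0\<close> both sides agree, so failure
    forces \<open>a < 0 < b\<close>; with these strict conditions \<open>D\<close> is open.\<close>
  then have "a \<noteq> 0" "b \<noteq> 0" by (auto simp: \<Phi>_def)
  then have D: "(z, a, b) \<in> D" using assms by (simp add: D_def e_def)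
  have D_eq: "D = (S \<times> {..<0} \<times> {0<..}) \<inter> (\<lambda>p. fst p + fst (snd p) *\<^sub>R e) -` S
      \<inter> (\<lambda>p. fst p + snd (snd p) *\<^sub>R e) -` S"
    by (auto simp: D_def)
  have "open D"
    unfolding D_eq by (intro open_Int open_Times open_vimage continuous_intros) (auto simp: open_S)
  moreover have "continuous_on D \<Phi>"
    unfolding \<Phi>_def case_prod_unfold
    by (intro continuous_intros continuous_on_compose2[OF continuous]) (auto simp: D_def)
  ultimately have W: "open (D \<inter> \<Phi> -` {0<..})"
    by (intro continuous_open_preimage) auto
  have "(z, a, b) \<in> D \<inter> \<Phi> -` {0<..}" using D pos by simp
  from open_prod_elim[OF W this] obtain A B
    where AB: "open A" "open B" "(z, a, b) \<in> A \<times> B" "A \<times> B \<subseteq> D \<inter> \<Phi> -` {0<..}" .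
  then have mem: "z \<in> A" "(a, b) \<in> B" by auto
  from open_prod_elim[OF AB(2) mem(2)] obtain A' B'
    where B: "open A'" "open B'" "(a, b) \<in> A' \<times> B'" "A' \<times> B' \<subseteq> B" .
  then have mem': "a \<in> A'" "b \<in> B'" by auto
  obtain q a' b' where q: "q \<in> A" "q \<in> F_points F" "a' \<in> A'" "a' \<in> F" "b' \<in> B'" "b' \<in> F"
    using F_points_dense[OF F AB(1) mem(1)] real_subfield_dense[OF F B(1) mem'(1)]
      real_subfield_dense[OF F B(2) mem'(2)] by auto
  then have qD: "(q, a', b') \<in> D" "\<Phi> (q, a', b') > 0" using AB(4) B(4) by blast+
  then have "\<Phi> (q, a', b') = (b' - a') * f q - b' * f (q + a' *\<^sub>R e) + a' * f (q + b' *\<^sub>R e)"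
    using extends[of q] extends[OF _ F_points_shift[OF F q(2)]] q(2,4,6)
    by (simp add: \<Phi>_def D_def e_def)
  moreover have "\<dots> \<le> 0"
    using jensen_F[of q a' b' i] q qD(1) by (simp add: D_def e_def)
  ultimately show False using qD(2) by simp
qed

lemma convex_on_axis_lines: "convex_on (S \<inter> axis_line x i) g"
proof (rule convex_onI)
  have line: "axis_line x i = range (\<lambda>t. x + t *\<^sub>R axis i 1)"
    by (auto simp: axis_line_def)
  have "convex (axis_line x i)"
  proof (rule convexI)
    fix y y' and u v :: real assume "y \<in> axis_line x i" "y' \<in> axis_line x i" "u + v = 1"
    then obtain s s' where y: "y = x + s *\<^sub>R axis i 1" "y' = x + s' *\<^sub>R axis i 1" by (auto simp: line)
    have "u *\<^sub>R y + v *\<^sub>R y' = (u + v) *\<^sub>R x + (u * s + v * s') *\<^sub>R axis i 1"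
      unfolding y by (simp add: algebra_simps)
    then show "u *\<^sub>R y + v *\<^sub>R y' \<in> axis_line x i" using \<open>u + v = 1\<close> by (simp add: line)
  qed
  then show "convex (S \<inter> axis_line x i)" using convex_S convex_Int by blast
  fix t :: real and y y' assume t: "0 < t" "t < 1" and y: "y \<in> S \<inter> axis_line x i" "y' \<in> S \<inter> axis_line x i"
  then obtain s s' where s: "y = x + s *\<^sub>R axis i 1" "y' = x + s' *\<^sub>R axis i 1" by (auto simp: line)
  \<comment> \<open>\<open>d\<close> is the signed length from \<open>y\<close> to
    \<open>y'\<close>; when it is negative, the two ends exchange their roles in
    \<open>jensen\<close>.\<close>
  define d where "d = s' - s"
  define z where "z = (1 - t) *\<^sub>R y + t *\<^sub>R y'"
  have zS: "z \<in> S" unfolding z_def using convexD_alt[OF convex_S, of y y' t] y t by simp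
  have yz: "z + (- t * d) *\<^sub>R axis i 1 = y" "z + ((1 - t) * d) *\<^sub>R axis i 1 = y'"
    by (simp_all add: z_def s d_def algebra_simps)
  have eq: "(1 - t) * d - - t * d = d" "- t * d - (1 - t) * d = - d" by (simp_all add: algebra_simps)
  consider "d > 0" | "d < 0" | "d = 0" by linarith
  then show "g ((1 - t) *\<^sub>R y + t *\<^sub>R y') \<le> (1 - t) * g y + t * g y'"
  proof cases
    case 1
    then have "d * g z \<le> (1 - t) * d * g y - (- t * d) * g y'"
      using jensen[OF zS, of "- t * d" "(1 - t) * d" i] t y unfolding yz eq by simp
    then have "d * g z \<le> d * ((1 - t) * g y + t * g y')" by (simp add: algebra_simps)
    then show ?thesis using 1 by (simp add: z_def)
  next
    case 2
    then have "(- d) * g z \<le> (- t * d) * g y' - ((1 - t) * d) * g y"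
      using jensen[OF zS, of "(1 - t) * d" "- t * d" i] t y unfolding yz eq
      by (simp add: mult_nonneg_nonpos)
    then have "(- d) * g z \<le> (- d) * ((1 - t) * g y + t * g y')" by (simp add: algebra_simps)
    then show ?thesis using 2 by (simp add: z_def)
  next
    case 3
    then have "y' = y" by (simp add: s d_def)
    then show ?thesis by (simp add: algebra_simps)
  qed
qed

text \<open>Near a point where a paraboloid touches \<open>g\<close> from above, the difference quotients of \<open>g\<close> in
  direction \<open>i\<close> differ from \<open>a $ i\<close> by less than \<open>1/4\<close>, which leaves only one integer slope.\<close>

lemma locally_integral_affine_where_touched:
  assumes p: "p \<in> S" and "\<delta> > 0"
    and touch: "\<And>w. w \<in> S \<Longrightarrow> dist p w < \<delta> \<Longrightarrow> g w \<le> g p + a \<bullet> (w - p) + C * (norm (w - p))\<^sup>2"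
  obtains m \<epsilon> where "\<And>i. m $ i \<in> \<int>" "\<epsilon> > 0" "ball p \<epsilon> \<subseteq> S"
    "\<And>w. w \<in> ball p \<epsilon> \<Longrightarrow> g w = g p + m \<bullet> (w - p)"
proof -
  obtain d where d: "d > 0" "ball p d \<subseteq> S" using open_S p openE by metis
  \<comment> \<open>The last bound on \<open>h\<close> makes the quadratic term at distance
    \<open>h\<close> smaller than \<open>h / 4\<close>.\<close>
  have "min (min d \<delta>) (1 / (4 * (\<bar>C\<bar> + 1))) > 0" using d \<open>\<delta> > 0\<close> by auto
  then obtain h where h: "h \<in> F" "h > 0" "h < d" "h < \<delta>" and hC: "h < 1 / (4 * (\<bar>C\<bar> + 1))"
    using Rats_dense_in_real[of 0] real_subfield_Rats[OF F] by (metis min_less_iff_conj)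
  have "h * (\<bar>C\<bar> + 1) < 1 / 4" using hC by (simp add: field_simps add_pos_nonneg)
  then have "\<bar>C\<bar> * h < 1 / 4" using h by (simp add: algebra_simps)
  then have "C * h < 1 / 4" using h abs_le_iff[of C] by (smt (verit) mult_right_mono)
  then have hC: "C * h\<^sup>2 < h / 4" using h by (simp add: power2_eq_square)
  have e: "norm (\<sigma> *\<^sub>R axis i 1 :: real ^ 'n) = h" if "\<sigma> \<in> {h, - h}" for \<sigma> i using that h by auto
  \<comment> \<open>Contact gives the strict inequality at \<open>p\<close> itself; continuity
    carries it to all nearby \<open>q\<close>.\<close>
  have near: "eventually (\<lambda>q. q + \<sigma> *\<^sub>R axis i 1 \<in> S \<and> g (q + \<sigma> *\<^sub>R axis i 1) - g q < \<sigma> * a $ i + h / 4) (nhds p)"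
    if \<sigma>: "\<sigma> \<in> {h, - h}" for \<sigma> i
  proof -
    have p\<sigma>: "p + \<sigma> *\<^sub>R axis i 1 \<in> S" using d e[OF \<sigma>, of i] h by (auto simp: dist_norm)
    have "g (p + \<sigma> *\<^sub>R axis i 1) \<le> g p + \<sigma> * a $ i + C * h\<^sup>2"
      using touch[OF p\<sigma>] e[OF \<sigma>, of i] h \<sigma> by (auto simp: dist_norm inner_axis)
    with hC have less: "g (p + \<sigma> *\<^sub>R axis i 1) - g p < \<sigma> * a $ i + h / 4" by simp
    have cont: "isCont g y" if "y \<in> S" for y
      using continuous open_S that by (simp add: continuous_on_eq_continuous_at)
    have lim: "((\<lambda>q. q + \<sigma> *\<^sub>R axis i 1) \<longlongrightarrow> p + \<sigma> *\<^sub>R axis i 1) (nhds p)"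
      by (intro tendsto_intros filterlim_ident)
    have "((\<lambda>q. g (q + \<sigma> *\<^sub>R axis i 1) - g q) \<longlongrightarrow> g (p + \<sigma> *\<^sub>R axis i 1) - g p) (nhds p)"
      by (intro tendsto_diff isCont_tendsto_compose[OF cont] lim p\<sigma> p filterlim_ident)
    from order_tendstoD(2)[OF this less] topological_tendstoD[OF lim open_S p\<sigma>]
    show ?thesis by eventually_elim simp
  qed
  have "eventually (\<lambda>q. \<forall>i. \<forall>\<sigma>\<in>{h, - h}. q + \<sigma> *\<^sub>R axis i 1 \<in> S
      \<and> g (q + \<sigma> *\<^sub>R axis i 1) - g q < \<sigma> * a $ i + h / 4) (nhds p)"
    by (intro eventually_all_finite eventually_ball_finite ballI near) auto
  then obtain \<epsilon> where \<epsilon>: "\<epsilon> > 0" and quot: "\<And>q i \<sigma>. dist q p < \<epsilon> \<Longrightarrow> \<sigma> \<in> {h, - h} \<Longrightarrow>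
      q + \<sigma> *\<^sub>R axis i 1 \<in> S \<and> g (q + \<sigma> *\<^sub>R axis i 1) - g q < \<sigma> * a $ i + h / 4"
    unfolding eventually_nhds_metric by blast
  define m :: "real ^ 'n" where "m = (\<chi> i. of_int (round (a $ i)))"
  \<comment> \<open>The bound \<open>h / 2\<close> keeps axial steps within \<open>U\<close> shorter
    than \<open>h\<close>; the other one puts \<open>U\<close> into the balls of radius
    \<open>d\<close> and \<open>\<epsilon>\<close> about \<open>p\<close>.\<close>
  define \<rho> where "\<rho> = min (h / 2) (min d \<epsilon> / (2 * CARD('n)))"
  have \<rho>: "\<rho> > 0" using h \<epsilon> d by (simp add: \<rho>_def)
  define U where "U = {w. \<forall>i. w $ i \<in> {p $ i - \<rho> <..< p $ i + \<rho>}}"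
  have U_box: "U = box (\<chi> i. p $ i - \<rho>) (\<chi> i. p $ i + \<rho>)"
    by (auto simp: U_def mem_box_cart)
  then have openU: "open U" by (simp add: open_box)
  have U_comp: "\<bar>w $ i - p $ i\<bar> < \<rho>" if "w \<in> U" for w i
    using that by (auto simp: U_def abs_less_iff dest!: spec[of _ i])
  have U_dist: "dist w p < min d \<epsilon>" if "w \<in> U" for w
  proof -
    have "norm (w - p) \<le> real CARD('n) * \<rho>"
      by (rule norm_le_of_components) (use U_comp[OF that] in \<open>auto intro: less_imp_le\<close>)
    also have "\<dots> \<le> real CARD('n) * (min d \<epsilon> / (2 * CARD('n)))"
      by (intro mult_left_mono) (auto simp: \<rho>_def)
    also have "\<dots> = min d \<epsilon> / 2" by simp
    finally show ?thesis using d \<epsilon> by (simp add: dist_norm)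
  qed
  have US: "U \<subseteq> S" using U_dist d by (auto simp: subset_eq dist_commute)
  have one: "f q + m $ i * s \<le> f (q + s *\<^sub>R axis i 1)"
    if q: "q \<in> U" "q \<in> F_points F" and s: "s \<in> F" "q + s *\<^sub>R axis i 1 \<in> U" for q s i
  proof -
    have "\<bar>s\<bar> < 2 * \<rho>"
      using U_comp[OF q(1), of i] U_comp[OF s(2), of i] by auto
    also have "\<dots> \<le> h" by (simp add: \<rho>_def)
    finally have "\<bar>s\<bar> \<le> h" by simp
    have qd: "dist q p < \<epsilon>" using U_dist q by auto
    have "- h \<in> F" using h by auto
    moreover have "q + h *\<^sub>R axis i 1 \<in> S" "q + (- h) *\<^sub>R axis i 1 \<in> S"
      using quot[OF qd, of h i] quot[OF qd, of "- h" i] by auto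
    ultimately obtain k where "k \<in> \<int>"
      and k: "\<And>s. s \<in> F \<Longrightarrow> - h \<le> s \<Longrightarrow> s \<le> h \<Longrightarrow> f q + k * s \<le> f (q + s *\<^sub>R axis i 1)"
      using subgradient[OF q(2), of "- h" h i] h by auto
    \<comment> \<open>The increments for \<open>h\<close> and \<open>- h\<close> squeeze the
      supporting slope \<open>k\<close> at \<open>q\<close> to within \<open>1 / 4\<close> of
      \<open>a $ i\<close>, so \<open>k\<close> is its rounding.\<close>
    have "k * \<sigma> < \<sigma> * a $ i + h / 4" if "\<sigma> \<in> {h, - h}" for \<sigma>
    proof -
      have "\<sigma> \<in> F" using that h by auto
      then have "q + \<sigma> *\<^sub>R axis i 1 \<in> F_points F" by (rule F_points_shift[OF F q(2)])
      then show ?thesis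
        using k[OF \<open>\<sigma> \<in> F\<close>] quot[OF qd that, of i] extends q US that h by force
    qed
    from this[of h] this[of "- h"] have "h * (k - a $ i) < h * (1 / 4)" "h * (a $ i - k) < h * (1 / 4)"
      by (auto simp: algebra_simps)
    then have "k - a $ i < 1 / 4" "a $ i - k < 1 / 4"
      using h by (simp_all only: mult_less_cancel_left_pos)
    then have ak: "\<bar>a $ i - k\<bar> < 1 / 2" by linarith
    from \<open>k \<in> \<int>\<close> obtain n where n: "k = of_int n" by (auto elim: Ints_cases)
    have "m $ i = k"
      using round_unique'[of "a $ i" n] ak by (simp add: m_def n)
    then show ?thesis using k[OF s(1)] \<open>\<bar>s\<bar> \<le> h\<close> by auto
  qed
  have affine_F: "f w' = f w + m \<bullet> (w' - w)"
    if w: "w \<in> U" "w' \<in> U" "w \<in> F_points F" "w' \<in> F_points F" for w w'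
  proof -
    \<comment> \<open>Supporting lines at both ends of an axial step have the same slope, so the
      inequality \<open>one\<close> becomes an equality; hence the constant
      \<open>0\<close>.\<close>
    have "\<bar>f w' - f w - m \<bullet> (w' - w)\<bar> \<le> 0 * (\<Sum>i\<in>UNIV. \<bar>w' $ i - w $ i\<bar>)"
    proof (rule coordinatewise_increment_bound)
      fix w :: "real ^ 'n" and j s
      assume w: "\<forall>i. w $ i \<in> {p $ i - \<rho> <..< p $ i + \<rho>} \<inter> F"
        and ws: "w $ j + s \<in> {p $ j - \<rho> <..< p $ j + \<rho>} \<inter> F"
      have s: "s \<in> F" using w ws F_closed(2)[of "w $ j + s" "w $ j"] by auto
      have F': "w \<in> F_points F" "w + s *\<^sub>R axis j 1 \<in> F_points F"
        using w s by (auto simp: F_points_def)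
      have U': "w \<in> U" "w + s *\<^sub>R axis j 1 \<in> U" using w ws by (auto simp: U_def)
      have "f w + m $ j * s \<le> f (w + s *\<^sub>R axis j 1)"
        using one[OF U'(1) F'(1) s U'(2)] .
      moreover have "f (w + s *\<^sub>R axis j 1) - m $ j * s \<le> f w"
        using one[OF U'(2) F'(2), of "- s" j] s U'(1) by auto
      ultimately show "\<bar>f (w + s *\<^sub>R axis j 1) - f w - m $ j * s\<bar> \<le> 0 * \<bar>s\<bar>" by auto
    qed (use w in \<open>auto simp: U_def F_points_def\<close>)
    then show ?thesis by simp
  qed
  have pU: "p \<in> U" using \<rho> by (simp add: U_def)
  obtain q where q: "q \<in> U" "q \<in> F_points F" using F_points_dense[OF F openU pU] by auto
  have gU: "g w = f q + m \<bullet> (w - q)" if "w \<in> U" for w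
  proof (rule continuous_eq_on_F_points[OF F openU, where g = g and h = "\<lambda>w. f q + m \<bullet> (w - q)"])
    show "continuous_on U g" using continuous US continuous_on_subset by blast
    show "g w = f q + m \<bullet> (w - q)" if "w \<in> U" "w \<in> F_points F" for w
      using affine_F[OF q(1) that(1) q(2) that(2)] extends that US by auto
  qed (auto intro!: continuous_intros that)
  have "g w = g p + m \<bullet> (w - p)" if "w \<in> U" for w
    using gU[OF pU] gU[OF that] by (simp add: algebra_simps)
  moreover obtain \<epsilon>' where "\<epsilon>' > 0" "ball p \<epsilon>' \<subseteq> U" using openU pU openE by metis
  ultimately show ?thesis using US by (intro that[of m \<epsilon>']) (auto simp: m_def)
qed

end

section \<open>Joint convexity from affineness at points of contact\<close>

text \<open>If \<open>g\<close> exceeded a chord between its endpoints, a suitable paraboloid, strictly concave along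
  the chord and steep across it, would touch \<open>g\<close> from above inside a thin tube around the chord;
  an affine function cannot lie below such a paraboloid near the point of contact.\<close>

lemma convex_on_if_affine_where_touched:
  fixes g :: "'a::euclidean_space \<Rightarrow> real"
  assumes S: "open S" "convex S" and cont: "continuous_on S g"
    and affine: "\<And>p a C \<delta>. \<lbrakk>p \<in> S; \<delta> > 0;
      \<And>w. w \<in> S \<Longrightarrow> dist p w < \<delta> \<Longrightarrow> g w \<le> g p + a \<bullet> (w - p) + C * (norm (w - p))\<^sup>2\<rbrakk> \<Longrightarrow>
      \<exists>m \<epsilon>. \<epsilon> > 0 \<and> (\<forall>w\<in>ball p \<epsilon>. g w = g p + m \<bullet> (w - p))"
  shows "convex_on S g"
proof (rule convex_onI)
  fix t x y assume t: "0 < t" "t < (1::real)" and xy: "x \<in> S" "y \<in> S"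
  show "g ((1 - t) *\<^sub>R x + t *\<^sub>R y) \<le> (1 - t) * g x + t * g y"
  proof (rule ccontr)
    define z where "z = (1 - t) *\<^sub>R x + t *\<^sub>R y"
    define \<eta> where "\<eta> = g z - ((1 - t) * g x + t * g y)"
    assume "\<not> ?thesis"
    then have \<eta>: "\<eta> > 0" by (simp add: \<eta>_def z_def)
    define v where "v = y - x"
    define N where "N = v \<bullet> v"
    have "x \<noteq> y" using \<eta> by (auto simp: \<eta>_def z_def algebra_simps)
    then have N: "N > 0" by (simp add: N_def v_def)
    \<comment> \<open>\<open>\<tau>\<close> is the parameter of the orthogonal projection to the
      line through \<open>x\<close> and \<open>y\<close>, and \<open>Q\<close> is the squared
      distance from that line.\<close>
    define \<tau> where "\<tau> w = v \<bullet> (w - x) / N" for w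
    define Q where "Q w = (w - x) \<bullet> (w - x) - N * (\<tau> w)\<^sup>2" for w
    \<comment> \<open>The subtracted parabola vanishes at both ends and is less than
      \<open>\<eta>\<close> at \<open>z\<close>, so \<open>G\<close> stays positive at
      \<open>z\<close> and is zero at \<open>x\<close> and \<open>y\<close>.\<close>
    define G where "G w = g w - (g x + \<tau> w * (g y - g x)) - \<eta> * (\<tau> w * (1 - \<tau> w))" for w
    have Q: "Q w = (norm (w - (x + \<tau> w *\<^sub>R v)))\<^sup>2" for w
    proof -
      have "v \<bullet> (w - x) = N * \<tau> w" using N by (simp add: \<tau>_def)
      moreover have "(norm (w - (x + \<tau> w *\<^sub>R v)))\<^sup>2
          = (w - x) \<bullet> (w - x) - 2 * \<tau> w * (v \<bullet> (w - x)) + (\<tau> w)\<^sup>2 * N"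
        unfolding power2_norm_eq_inner N_def
        by (simp add: inner_diff inner_add inner_commute power2_eq_square algebra_simps)
      ultimately show ?thesis by (simp add: Q_def power2_eq_square)
    qed
    have Q0: "Q w \<ge> 0" for w by (simp add: Q)
    have z: "z - x = t *\<^sub>R v" by (simp add: z_def v_def algebra_simps)
    have \<tau>z: "\<tau> z = t" using N by (simp add: \<tau>_def z N_def)
    have Qz: "Q z = 0" by (simp add: Q_def z \<tau>z N_def power2_eq_square)
    have "\<eta> * (t * (1 - t)) < \<eta> * 1"
    proof (rule mult_strict_left_mono)
      have "t * (1 - t) < 1 * 1" using t by (intro mult_strict_mono) auto
      then show "t * (1 - t) < 1" by simp
    qed (rule \<eta>)
    then have Gz: "G z > 0" by (simp add: G_def \<tau>z \<eta>_def algebra_simps)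
    have \<tau>xy: "\<tau> x = 0" "\<tau> y = 1" using N by (simp_all add: \<tau>_def N_def v_def)
    then have Gxy: "G x = 0" "G y = 0" by (simp_all add: G_def)
    have cont_\<tau>: "continuous_on A \<tau>" for A unfolding \<tau>_def by (intro continuous_intros) (use N in auto)
    have cont_Q: "continuous_on A Q" for A
      unfolding Q_def by (intro continuous_intros cont_\<tau>)
    have cont_G: "continuous_on S G"
      unfolding G_def by (intro continuous_intros cont_\<tau> cont)
    have ends: "\<exists>r>0. \<forall>w. dist w e \<le> r \<longrightarrow> G w < G z" if "e \<in> {x, y}" for e
    proof -
      have "open (S \<inter> G -` {..<G z})" by (rule continuous_open_preimage[OF cont_G]) (use S in auto)
      moreover have "e \<in> S \<inter> G -` {..<G z}" using that xy Gxy Gz by auto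
      ultimately obtain r where "r > 0" "cball e r \<subseteq> S \<inter> G -` {..<G z}"
        by (meson open_contains_cball)
      then show ?thesis by (intro exI[of _ r]) (auto simp: subset_eq dist_commute)
    qed
    obtain r\<^sub>x r\<^sub>y where r\<^sub>x: "r\<^sub>x > 0" "\<And>w. dist w x \<le> r\<^sub>x \<Longrightarrow> G w < G z"
      and r\<^sub>y: "r\<^sub>y > 0" "\<And>w. dist w y \<le> r\<^sub>y \<Longrightarrow> G w < G z"
      using ends[of x] ends[of y] by auto
    have "closed_segment x y \<subseteq> S" using xy S by (simp add: closed_segment_subset)
    then obtain r\<^sub>0 where r\<^sub>0: "r\<^sub>0 > 0" "{w. infdist w (closed_segment x y) \<le> r\<^sub>0} \<subseteq> S"
      using compact_in_open_separated[of "closed_segment x y" S] S by auto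
    \<comment> \<open>\<open>r\<^sub>0\<close> keeps the tube \<open>T\<close> of radius
      \<open>r\<close> inside \<open>S\<close>; \<open>r\<^sub>x\<close> and
      \<open>r\<^sub>y\<close> make \<open>G\<close> smaller than \<open>G z\<close> on its end
      discs.\<close>
    define r where "r = min r\<^sub>0 (min r\<^sub>x r\<^sub>y)"
    have r: "r > 0" using r\<^sub>0 r\<^sub>x r\<^sub>y by (simp add: r_def)
    define T where "T = {w. 0 \<le> \<tau> w \<and> \<tau> w \<le> 1 \<and> Q w \<le> r\<^sup>2}"
    have T_dist: "dist w (x + \<tau> w *\<^sub>R v) \<le> r" if "w \<in> T" for w
      using that r by (auto simp: T_def Q dist_norm intro: power2_le_imp_le)
    have "T \<subseteq> S"
    proof
      fix w assume w: "w \<in> T"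
      have "x + \<tau> w *\<^sub>R v = (1 - \<tau> w) *\<^sub>R x + \<tau> w *\<^sub>R y" by (simp add: v_def algebra_simps)
      then have "x + \<tau> w *\<^sub>R v \<in> closed_segment x y"
        using w by (auto simp: T_def closed_segment_def)
      then have "infdist w (closed_segment x y) \<le> r"
        using T_dist[OF w] infdist_le order_trans by blast
      then show "w \<in> S" using r\<^sub>0 by (auto simp: r_def)
    qed
    have "T \<subseteq> cball x (r + norm v)"
    proof
      fix w assume w: "w \<in> T"
      have "norm (w - x) \<le> norm (w - (x + \<tau> w *\<^sub>R v)) + norm (\<tau> w *\<^sub>R v)"
        using norm_triangle_ineq[of "w - (x + \<tau> w *\<^sub>R v)" "\<tau> w *\<^sub>R v"] by simp
      also have "\<dots> \<le> r + norm v"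
        using T_dist[OF w] w by (auto simp: T_def dist_norm intro!: add_mono mult_left_le_one_le)
      finally show "w \<in> cball x (r + norm v)" by (simp add: dist_norm norm_minus_commute)
    qed
    moreover have "closed T"
    proof -
      have "T = {w. 0 \<le> \<tau> w} \<inter> {w. \<tau> w \<le> 1} \<inter> {w. Q w \<le> r\<^sup>2}" by (auto simp: T_def)
      then show ?thesis
        using cont_\<tau> cont_Q by (auto intro!: closed_Int closed_Collect_le continuous_on_const)
    qed
    ultimately have "compact T"
      using bounded_cball bounded_subset compact_eq_bounded_closed by blast
    have zT: "z \<in> T" using t r by (simp add: T_def \<tau>z Qz)
    have cont_GT: "continuous_on T G" using cont_G \<open>T \<subseteq> S\<close> continuous_on_subset by blast
    obtain B where B: "\<And>w. w \<in> T \<Longrightarrow> G w \<le> B"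
      using continuous_attains_sup[OF \<open>compact T\<close> _ cont_GT] zT by blast
    \<comment> \<open>On the lateral boundary \<open>Q = r^2\<close> the penalty
      \<open>K * Q\<close> equals the absolute value of \<open>B\<close>, so the penalised
      \<open>G\<close> is at most 0 there, below its value at \<open>z\<close>.\<close>
    define K where "K = \<bar>B\<bar> / r\<^sup>2"
    have K: "K \<ge> 0" "K * r\<^sup>2 = \<bar>B\<bar>" using r by (auto simp: K_def)
    have "continuous_on T (\<lambda>w. G w - K * Q w)" by (intro continuous_intros cont_GT cont_Q)
    then obtain p where p: "p \<in> T" and pmax: "\<And>w. w \<in> T \<Longrightarrow> G w - K * Q w \<le> G p - K * Q p"
      using continuous_attains_sup[OF \<open>compact T\<close>, of "\<lambda>w. G w - K * Q w"] zT by blast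
    have Gp: "G z \<le> G p - K * Q p" using pmax[OF zT] Qz by simp
    then have "G z \<le> G p" using K Q0[of p] mult_nonneg_nonneg[of K "Q p"] by linarith
    have "\<tau> p \<noteq> 0"
    proof
      assume "\<tau> p = 0"
      then have "dist p x \<le> r\<^sub>x" using T_dist[OF p] by (simp add: r_def)
      then show False using r\<^sub>x(2) \<open>G z \<le> G p\<close> by force
    qed
    moreover have "\<tau> p \<noteq> 1"
    proof
      assume "\<tau> p = 1"
      then have "dist p y \<le> r\<^sub>y" using T_dist[OF p] by (simp add: r_def v_def)
      then show False using r\<^sub>y(2) \<open>G z \<le> G p\<close> by force
    qed
    moreover have "Q p \<noteq> r\<^sup>2"
    proof
      assume "Q p = r\<^sup>2"
      then have "G p - K * Q p \<le> 0" using B[OF p] K by simp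
      then show False using Gp Gz by linarith
    qed
    ultimately have p': "p \<in> {w. 0 < \<tau> w} \<inter> {w. \<tau> w < 1} \<inter> {w. Q w < r\<^sup>2}" (is "p \<in> ?I")
      using p by (auto simp: T_def)
    have "open ?I"
      using cont_\<tau> cont_Q by (auto intro!: open_Int open_Collect_less continuous_on_const)
    then obtain \<delta> where \<delta>: "\<delta> > 0" "ball p \<delta> \<subseteq> ?I" using p' openE by metis
    \<comment> \<open>The gradient at \<open>p\<close> of the touching paraboloid, which is the
      chord function plus \<open>\<eta> * (\<tau> w * (1 - \<tau> w)) + K * Q w\<close>.\<close>
    define a where "a = ((g y - g x + \<eta> * (1 - 2 * \<tau> p) - 2 * K * N * \<tau> p) / N) *\<^sub>R v + (2 * K) *\<^sub>R (p - x)"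
    \<comment> \<open>The expansion about \<open>p\<close> is exact. At
      \<open>w = p + \<sigma> *\<^sub>R v\<close> the two quadratic terms combine to
      \<open>- \<eta> * \<sigma>^2\<close>, which is the strict concavity along the chord.\<close>
    have bound: "g w \<le> g p + a \<bullet> (w - p) + K * (norm (w - p))\<^sup>2 - (\<eta> + K * N) * (v \<bullet> (w - p) / N)\<^sup>2"
      if w: "dist p w < \<delta>" for w
    proof -
      define \<sigma> where "\<sigma> = v \<bullet> (w - p) / N"
      have "w \<in> ?I" using w \<delta>(2) mem_ball by blast
      then have "w \<in> T" by (simp add: T_def)
      then have "G w - K * Q w \<le> G p - K * Q p" by (rule pmax)
      moreover have \<tau>w: "\<tau> w = \<tau> p + \<sigma>"
        by (simp add: \<tau>_def \<sigma>_def inner_diff_right flip: add_divide_distrib)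
      have "Q w - Q p = 2 * ((p - x) \<bullet> (w - p)) + (norm (w - p))\<^sup>2 - N * (2 * \<tau> p * \<sigma> + \<sigma>\<^sup>2)"
        unfolding Q_def \<tau>w power2_norm_eq_inner
        by (simp add: inner_diff inner_commute power2_eq_square algebra_simps)
      then have "K * (Q w - Q p) = K * (2 * ((p - x) \<bullet> (w - p)) + (norm (w - p))\<^sup>2 - N * (2 * \<tau> p * \<sigma> + \<sigma>\<^sup>2))"
        by simp
      moreover have "a \<bullet> (w - p) = (g y - g x + \<eta> * (1 - 2 * \<tau> p) - 2 * K * N * \<tau> p) * \<sigma> + 2 * K * ((p - x) \<bullet> (w - p))"
        by (simp add: a_def \<sigma>_def inner_add_left)
      ultimately show ?thesis
        unfolding G_def \<tau>w \<sigma>_def[symmetric] by (simp add: power2_eq_square algebra_simps)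
    qed
    have "\<exists>m \<epsilon>. \<epsilon> > 0 \<and> (\<forall>w\<in>ball p \<epsilon>. g w = g p + m \<bullet> (w - p))"
    proof (rule affine[OF _ \<delta>(1)])
      show "p \<in> S" using p \<open>T \<subseteq> S\<close> by auto
      fix w assume "dist p w < \<delta>"
      moreover have "(\<eta> + K * N) * (v \<bullet> (w - p) / N)\<^sup>2 \<ge> 0" using \<eta> K N by auto
      ultimately show "g w \<le> g p + a \<bullet> (w - p) + K * (norm (w - p))\<^sup>2" using bound[of w] by linarith
    qed
    then obtain m \<epsilon> where m: "\<epsilon> > 0" "\<And>w. w \<in> ball p \<epsilon> \<Longrightarrow> g w = g p + m \<bullet> (w - p)" by blast
    define s where "s = min \<delta> \<epsilon> / (2 * norm v)"
    have nv: "norm v > 0" using \<open>x \<noteq> y\<close> by (simp add: v_def)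
    have s: "s > 0" using \<delta> m nv by (simp add: s_def)
    have sv: "s * norm v = min \<delta> \<epsilon> / 2" using nv by (simp add: s_def)
    \<comment> \<open>Adding the estimates for the opposite steps \<open>s\<close> and
      \<open>- s\<close> cancels the linear terms and leaves only the concave one.\<close>
    have "\<sigma> * (m \<bullet> v) \<le> \<sigma> * (a \<bullet> v) - \<eta> * s\<^sup>2" if "\<sigma> \<in> {s, - s}" for \<sigma>
    proof -
      have \<sigma>2: "\<sigma>\<^sup>2 = s\<^sup>2" "\<bar>\<sigma>\<bar> = s" using that s by auto
      have "dist p (p + \<sigma> *\<^sub>R v) < min \<delta> \<epsilon>"
        unfolding dist_norm using sv \<delta>(1) m(1) \<sigma>2(2) by (simp del: min_less_iff_conj)
      then have "m \<bullet> (\<sigma> *\<^sub>R v) \<le> a \<bullet> (\<sigma> *\<^sub>R v) + K * (norm (\<sigma> *\<^sub>R v))\<^sup>2 - (\<eta> + K * N) * (v \<bullet> (\<sigma> *\<^sub>R v) / N)\<^sup>2"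
        using bound[of "p + \<sigma> *\<^sub>R v"] m(2)[of "p + \<sigma> *\<^sub>R v"] by simp
      moreover have n: "(norm (\<sigma> *\<^sub>R v))\<^sup>2 = s\<^sup>2 * N"
        by (simp only: norm_scaleR power_mult_distrib power2_norm_eq_inner N_def \<sigma>2)
      moreover have v: "v \<bullet> (\<sigma> *\<^sub>R v) / N = \<sigma>" using N by (simp add: N_def)
      ultimately have "m \<bullet> (\<sigma> *\<^sub>R v) \<le> a \<bullet> (\<sigma> *\<^sub>R v) + K * (s\<^sup>2 * N) - (\<eta> + K * N) * s\<^sup>2"
        unfolding n v \<sigma>2 by blast
      then show ?thesis by (simp add: algebra_simps)
    qed
    from this[of s] this[of "- s"] have "\<eta> * s\<^sup>2 \<le> 0" by simp
    then show False using \<eta> s by (simp add: mult_le_0_iff)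
  qed
qed (rule S)

section \<open>Global integral supports and local polyhedrality\<close>

context integer_subgradients_extension
begin

lemma convex_extension: "convex_on S g"
  using open_S convex_S continuous
proof (rule convex_on_if_affine_where_touched)
  fix p a C and \<delta> :: real
  assume "p \<in> S" "\<delta> > 0" "\<And>w. w \<in> S \<Longrightarrow> dist p w < \<delta> \<Longrightarrow> g w \<le> g p + a \<bullet> (w - p) + C * (norm (w - p))\<^sup>2"
  from locally_integral_affine_where_touched[OF this]
  show "\<exists>m \<epsilon>. \<epsilon> > 0 \<and> (\<forall>w\<in>ball p \<epsilon>. g w = g p + m \<bullet> (w - p))" by metis
qed

text \<open>The affine minorant is kept as a pair of gradient and constant so that supports can be
  counted.\<close>

definition integral_support :: "real ^ 'n \<Rightarrow> real ^ 'n \<Rightarrow> real \<Rightarrow> bool" where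
  "integral_support p m b \<longleftrightarrow>
     (\<forall>i. m $ i \<in> \<int>) \<and> b \<in> F \<and> g p = m \<bullet> p + b \<and> (\<forall>w\<in>S. m \<bullet> w + b \<le> g w)"

text \<open>A steep paraboloid centred in \<open>V\<close> touches \<open>g\<close> from above at
  some point of \<open>V\<close>. There \<open>g\<close> is affine with integer gradient, and joint
  convexity makes this affine piece a minorant on all of \<open>S\<close>.\<close>

lemma integral_support_dense:
  assumes V: "open V" "V \<subseteq> S" "V \<noteq> {}"
  obtains p m b where "p \<in> V" "integral_support p m b"
proof -
  obtain w\<^sub>0 \<rho> where \<rho>: "\<rho> > 0" "cball w\<^sub>0 \<rho> \<subseteq> V" using V open_contains_cball by blast
  have cont: "continuous_on (cball w\<^sub>0 \<rho>) g"
    using continuous \<rho> V continuous_on_subset by (metis order_trans)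
  then have "bounded (g ` cball w\<^sub>0 \<rho>)"
    using compact_continuous_image compact_cball compact_imp_bounded by blast
  then obtain M where M: "\<And>w. w \<in> cball w\<^sub>0 \<rho> \<Longrightarrow> \<bar>g w\<bar> \<le> M"
    unfolding bounded_iff real_norm_def by blast
  \<comment> \<open>On the boundary sphere the penalty is \<open>2 * M + 1\<close>, more than
    \<open>g\<close> can vary on the ball, so the maximiser is interior.\<close>
  define K where "K = (2 * M + 1) / \<rho>\<^sup>2"
  have K: "K * \<rho>\<^sup>2 = 2 * M + 1" using \<rho> by (simp add: K_def)
  have "continuous_on (cball w\<^sub>0 \<rho>) (\<lambda>w. g w - K * (norm (w - w\<^sub>0))\<^sup>2)"
    by (intro continuous_intros cont)
  then obtain p where p: "p \<in> cball w\<^sub>0 \<rho>" and pmax: "\<And>w. w \<in> cball w\<^sub>0 \<rho> \<Longrightarrow>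
      g w - K * (norm (w - w\<^sub>0))\<^sup>2 \<le> g p - K * (norm (p - w\<^sub>0))\<^sup>2"
    using continuous_attains_sup[OF compact_cball, of w\<^sub>0 \<rho> "\<lambda>w. g w - K * (norm (w - w\<^sub>0))\<^sup>2"] \<rho>
    by auto
  have "norm (p - w\<^sub>0) \<noteq> \<rho>"
  proof
    assume "norm (p - w\<^sub>0) = \<rho>"
    then have "g w\<^sub>0 \<le> g p - (2 * M + 1)" using pmax[of w\<^sub>0] \<rho> K by simp
    then show False using M[OF p] M[of w\<^sub>0] \<rho> by auto
  qed
  then have lt: "dist p w\<^sub>0 < \<rho>" using p by (auto simp: dist_norm norm_minus_commute)
  have pS: "p \<in> S" using p \<rho> V by auto
  have touch: "g w \<le> g p + (2 * K) *\<^sub>R (p - w\<^sub>0) \<bullet> (w - p) + K * (norm (w - p))\<^sup>2"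
    if "dist p w < \<rho> - dist p w\<^sub>0" for w
  proof -
    have "w \<in> cball w\<^sub>0 \<rho>" using that dist_triangle[of w\<^sub>0 w p] by (simp add: dist_commute)
    from pmax[OF this]
    have "g w \<le> g p + K * ((norm (w - w\<^sub>0))\<^sup>2 - (norm (p - w\<^sub>0))\<^sup>2)" by (simp add: algebra_simps)
    also have "(norm (w - w\<^sub>0))\<^sup>2 - (norm (p - w\<^sub>0))\<^sup>2 = 2 * ((p - w\<^sub>0) \<bullet> (w - p)) + (norm (w - p))\<^sup>2"
      unfolding power2_norm_eq_inner by (simp add: inner_diff inner_commute algebra_simps)
    finally show ?thesis by (simp add: algebra_simps)
  qed
  have "\<rho> - dist p w\<^sub>0 > 0" using lt by simp
  from locally_integral_affine_where_touched[OF pS this touch]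
  obtain m \<epsilon> where m: "\<And>i. m $ i \<in> \<int>" and \<epsilon>: "\<epsilon> > 0" "ball p \<epsilon> \<subseteq> S"
    and affine: "\<And>w. w \<in> ball p \<epsilon> \<Longrightarrow> g w = g p + m \<bullet> (w - p)"
    by blast
  define b where "b = g p - m \<bullet> p"
  \<comment> \<open>The coordinates of \<open>p\<close> may lie outside \<open>F\<close>, so the
    constant \<open>b\<close> is read off at a nearby \<open>q\<close>.\<close>
  obtain q where q: "q \<in> ball p \<epsilon>" "q \<in> F_points F"
    using F_points_dense[OF F, of "ball p \<epsilon>" p] \<epsilon> by auto
  have "b = f q - m \<bullet> q"
    using affine[OF q(1)] extends[of q] q \<epsilon> by (auto simp: b_def inner_diff_right)
  moreover have "m \<bullet> q \<in> F"
    using q(2) real_subfield_Ints[OF F m]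
    by (auto simp: inner_vec_def F_points_def intro!: real_subfield_sum[OF F])
  moreover have "f q \<in> F" using value_in_F[of q] q \<epsilon> by auto
  ultimately have "b \<in> F" by auto
  moreover have "m \<bullet> w + b \<le> g w" if w: "w \<in> S" for w
  proof -
    \<comment> \<open>A step of relative length \<open>s\<close> from \<open>p\<close> towards
      \<open>w\<close> stays where \<open>g\<close> is affine; convexity on the segment then bounds
      \<open>g w\<close> from below.\<close>
    define s where "s = min (1 / 2) (\<epsilon> / (2 * (norm (w - p) + 1)))"
    have n: "norm (w - p) + 1 > 0" by (simp add: add_nonneg_pos)
    have s: "0 < s" "s \<le> 1" using \<epsilon> n by (auto simp: s_def)
    have "s * norm (w - p) \<le> s * (norm (w - p) + 1)" using s by simp
    also have "\<dots> \<le> \<epsilon> / (2 * (norm (w - p) + 1)) * (norm (w - p) + 1)"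
      using n by (intro mult_right_mono) (auto simp: s_def)
    also have "\<dots> = \<epsilon> / 2" using n by (simp add: field_simps)
    finally have "p + s *\<^sub>R (w - p) \<in> ball p \<epsilon>" using \<epsilon> s by (simp add: dist_norm)
    then have "g p + s * (m \<bullet> (w - p)) = g ((1 - s) *\<^sub>R p + s *\<^sub>R w)"
      using affine[of "p + s *\<^sub>R (w - p)"] by (simp add: algebra_simps)
    also have "\<dots> \<le> (1 - s) * g p + s * g w"
      using convex_onD[OF convex_extension, of s p w] s pS w by simp
    finally have "s * (m \<bullet> (w - p)) \<le> s * (g w - g p)" by (simp add: algebra_simps)
    then show ?thesis using s by (simp add: b_def inner_diff_right)
  qed
  ultimately have "integral_support p m b" using m by (simp add: integral_support_def b_def)
  then show ?thesis using that p \<rho> by blast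
qed

text \<open>Comparing a support with \<open>g\<close> after axial steps of length \<open>r\<close>
  from its contact point bounds its integer gradient, and the gradient determines the
  constant.\<close>

lemma finite_integral_supports:
  assumes r: "r > 0" "cball x (2 * r) \<subseteq> S"
  shows "finite {(m, b). \<exists>p\<in>ball x r. integral_support p m b}" (is "finite ?P")
proof -
  have "continuous_on (cball x (2 * r)) g" using continuous r continuous_on_subset by blast
  then have "bounded (g ` cball x (2 * r))"
    using compact_continuous_image compact_cball compact_imp_bounded by blast
  then obtain M where M: "\<And>w. w \<in> cball x (2 * r) \<Longrightarrow> \<bar>g w\<bar> \<le> M"
    unfolding bounded_iff real_norm_def by blast
  have "\<bar>m $ i\<bar> \<le> 2 * M / r" if sup: "integral_support p m b" and p: "p \<in> ball x r" for m b p i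
  proof -
    have "m $ i * \<sigma> \<le> 2 * M" if "\<sigma> \<in> {r, - r}" for \<sigma>
    proof -
      have "dist x (p + \<sigma> *\<^sub>R axis i 1) \<le> dist x p + dist p (p + \<sigma> *\<^sub>R axis i 1)"
        by (rule dist_triangle)
      also have "\<dots> \<le> 2 * r" using that r p by (auto simp: dist_norm)
      finally have mem: "p + \<sigma> *\<^sub>R axis i 1 \<in> cball x (2 * r)" by simp
      then have "m \<bullet> (p + \<sigma> *\<^sub>R axis i 1) + b \<le> g (p + \<sigma> *\<^sub>R axis i 1)"
        using sup r by (auto simp: integral_support_def)
      then have "g p + m $ i * \<sigma> \<le> g (p + \<sigma> *\<^sub>R axis i 1)"
        using sup by (simp add: integral_support_def inner_add_right inner_axis algebra_simps)
      moreover have "\<bar>g p\<bar> \<le> M" using p r by (intro M) auto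
      ultimately show ?thesis using M[OF mem] by linarith
    qed
    from this[of r] this[of "- r"] have "\<bar>m $ i * r\<bar> \<le> 2 * M" by auto
    then show ?thesis using r by (simp add: abs_mult field_simps)
  qed
  then have "fst ` ?P \<subseteq> {m. \<forall>i. m $ i \<in> {k \<in> \<int>. \<bar>k\<bar> \<le> 2 * M / r}}"
    by (auto simp: integral_support_def)
  then have "finite (fst ` ?P)"
    by (rule finite_subset) (intro finite_vec_of_components finite_abs_int_segment)
  moreover have "inj_on fst ?P"
  proof -
    \<comment> \<open>The first functional is at most \<open>g\<close> at \<open>p'\<close>, where
      the second one equals \<open>g\<close>; exchanging them gives equality.\<close>
    have "b \<le> b'" if "integral_support p m b" "integral_support p' m b'" "p' \<in> ball x r" for m b b' p p'
    proof -
      have "p' \<in> S" using that(3) r by auto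
      then have "m \<bullet> p' + b \<le> m \<bullet> p' + b'" using that(1,2) by (metis integral_support_def)
      then show ?thesis by simp
    qed
    then show ?thesis by (auto intro!: inj_onI antisym)
  qed
  ultimately show ?thesis using finite_imageD by blast
qed

text \<open>Near \<open>x\<close>, \<open>g\<close> is the maximum of the finitely many supports
  that touch it in a small ball. If it differed from all of them at some point, it would do so on an
  open set, and that set would contain a contact point of one of them.\<close>

lemma locally_polyhedral: "locally_F_integral_polyhedral_on F S g"
  unfolding locally_F_integral_polyhedral_on_def
proof
  fix x assume "x \<in> S"
  then obtain R where "R > 0" "cball x R \<subseteq> S" using open_S open_contains_cball by blast
  then obtain r where r: "r > 0" "cball x (2 * r) \<subseteq> S"
    by (metis half_gt_zero nonzero_mult_div_cancel_left times_divide_eq_right zero_neq_numeral)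
  then have ball: "ball x r \<subseteq> S" by auto
  define P where "P = {(m, b). \<exists>p\<in>ball x r. integral_support p m b}"
  have "finite P" unfolding P_def using r by (rule finite_integral_supports)
  define L where "L = (\<lambda>(m, b) w. m \<bullet> w + b) ` P"
  have L: "finite L" "L \<noteq> {}"
  proof -
    obtain p m b where "p \<in> ball x r" "integral_support p m b"
      using integral_support_dense[of "ball x r"] ball r by auto
    then have "(m, b) \<in> P" by (auto simp: P_def)
    then show "finite L" "L \<noteq> {}" using \<open>finite P\<close> by (auto simp: L_def)
  qed
  have attained: "g w \<in> (\<lambda>l. l w) ` L" if "w \<in> ball x r" for w
  proof (rule ccontr)
    assume w: "g w \<notin> (\<lambda>l. l w) ` L"
    define V where "V = (\<Inter>l\<in>L. ball x r \<inter> (\<lambda>w. g w - l w) -` (- {0}))"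
    have "open V" unfolding V_def
    proof (intro open_INT ballI)
      fix l assume "l \<in> L"
      then have "continuous_on (ball x r) l" by (auto simp: L_def intro!: continuous_intros)
      moreover have "continuous_on (ball x r) g" using continuous ball continuous_on_subset by blast
      ultimately show "open (ball x r \<inter> (\<lambda>w. g w - l w) -` (- {0}))"
        by (intro continuous_open_preimage continuous_intros) auto
    qed (rule L)
    moreover have "V \<subseteq> ball x r" using L by (auto simp: V_def)
    moreover have "w \<in> V" using w that by (force simp: V_def)
    ultimately obtain p m b where p: "p \<in> V" "integral_support p m b"
      using integral_support_dense[of V] ball by blast
    then have "(\<lambda>w. m \<bullet> w + b) \<in> L"
      using \<open>V \<subseteq> ball x r\<close> by (force simp: L_def P_def)
    from INT_D[OF p(1)[unfolded V_def] this] have "g p \<noteq> m \<bullet> p + b" by simp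
    then show False using p(2) by (simp add: integral_support_def)
  qed
  obtain ls where ls: "set ls = L" using finite_list[OF L(1)] by blast
  have "F_integral_polyhedral_on F (ball x r \<inter> S) g"
    unfolding F_integral_polyhedral_on_def
  proof (intro exI[of _ ls] conjI ballI)
    show "ls \<noteq> []" using L ls by auto
    show "F_integral_affine F l" if "l \<in> set ls" for l
      using that unfolding ls L_def P_def F_integral_affine_def integral_support_def by auto
    fix w assume w: "w \<in> ball x r \<inter> S"
    have "l w \<le> g w" if "l \<in> L" for l
      using that w by (auto simp: L_def P_def integral_support_def)
    then have "Max ((\<lambda>l. l w) ` L) = g w"
      using attained[of w] w L by (intro Max_eqI) auto
    then show "g w = Max ((\<lambda>l. l w) ` set ls)" by (simp add: ls)
  qed
  then show "\<exists>U. open U \<and> x \<in> U \<and> F_integral_polyhedral_on F (U \<inter> S) g"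
    using r by (intro exI[of _ "ball x r"]) auto
qed

end

section \<open>From the polyhedral hypothesis to the theorem\<close>

lemma F_integral_affine_in_F:
  assumes F: "real_subfield F" and l: "F_integral_affine F l" and q: "q \<in> F_points F"
  shows "l q \<in> F"
proof -
  obtain a b where "\<forall>i. a $ i \<in> \<int>" "b \<in> F" "l = (\<lambda>x. a \<bullet> x + b)"
    using l by (auto simp: F_integral_affine_def)
  moreover from this have "a $ i * q $ i \<in> F" for i
    using q real_subfield_mult[OF F real_subfield_Ints[OF F]] by (simp add: F_points_def)
  ultimately show ?thesis
    by (simp add: inner_vec_def real_subfield_add[OF F] real_subfield_sum[OF F])
qed

lemma axis_segment_eq:
  fixes p :: "real ^ 'n"
  assumes "a \<le> b"
  shows "closed_segment (p + a *\<^sub>R axis i 1) (p + b *\<^sub>R axis i 1) = (\<lambda>s. p + s *\<^sub>R axis i 1) ` {a..b}"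
    (is "?L = ?R")
proof -
  have "?L = (+) p ` closed_segment (a *\<^sub>R axis i 1) (b *\<^sub>R axis i 1)"
    by (simp add: closed_segment_translation)
  also have "closed_segment (a *\<^sub>R axis i 1) (b *\<^sub>R axis i 1) = (\<lambda>s. s *\<^sub>R axis i 1 :: real ^ 'n) ` closed_segment a b"
    by (rule closed_segment_linear_image) (simp add: linear_iff algebra_simps)
  finally show ?thesis using assms by (simp add: closed_segment_eq_real_ivl image_image)
qed

text \<open>The segment is a box degenerate in every coordinate except \<open>i\<close>; two
  halfspaces per coordinate, with normals \<open>axis j 1\<close> and \<open>- axis j 1\<close>, cut
  it out.\<close>

lemma F_rational_axis_segment:
  fixes p :: "real ^ 'n"
  assumes F: "real_subfield F" and p: "p \<in> F_points F" and ab: "a \<in> F" "b \<in> F" "a < b"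
  shows "F_rational_segment F (closed_segment (p + a *\<^sub>R axis i 1) (p + b *\<^sub>R axis i 1))"
    (is "F_rational_segment F ?L")
proof -
  define lo where "lo = p + a *\<^sub>R axis i 1"
  define hi where "hi = p + b *\<^sub>R axis i 1"
  have lohi: "lo \<in> F_points F" "hi \<in> F_points F"
    using F_points_shift[OF F p] ab by (auto simp: lo_def hi_def)
  define \<H> where "\<H> = range (\<lambda>j. {x :: real ^ 'n. axis j 1 \<bullet> x + (- lo $ j) \<ge> 0})
      \<union> range (\<lambda>j. {x :: real ^ 'n. (- axis j 1) \<bullet> x + hi $ j \<ge> 0})"
  have "F_rational_halfspace F H" if "H \<in> \<H>" for H
  proof -
    have ax: "axis j (1::real) \<noteq> 0" for j :: 'n by (simp add: axis_eq_0_iff)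
    consider j where "H = {x. axis j 1 \<bullet> x + (- lo $ j) \<ge> 0}"
      | j where "H = {x. (- axis j 1) \<bullet> x + hi $ j \<ge> 0}"
      using \<open>H \<in> \<H>\<close> by (auto simp: \<H>_def)
    then show ?thesis
    proof cases
      case 1
      then show ?thesis
        using lohi ax real_subfield_uminus[OF F] unfolding F_rational_halfspace_def
        by (intro exI[of _ "axis j 1"] exI[of _ "- lo $ j"]) (auto simp: F_points_def)
    next
      case 2
      then show ?thesis
        using lohi ax unfolding F_rational_halfspace_def
        by (intro exI[of _ "- axis j 1"] exI[of _ "hi $ j"]) (auto simp: F_points_def)
    qed
  qed
  moreover have "?L = \<Inter>\<H>"
  proof -
    have "\<Inter>\<H> = {x. \<forall>j. lo $ j \<le> x $ j \<and> x $ j \<le> hi $ j}"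
      by (auto simp: \<H>_def inner_axis' )
    also have "\<dots> = (\<lambda>s. p + s *\<^sub>R axis i 1) ` {a..b}"
    proof (intro equalityI subsetI)
      fix x assume "x \<in> {x. \<forall>j. lo $ j \<le> x $ j \<and> x $ j \<le> hi $ j}"
      then have x: "\<And>j. lo $ j \<le> x $ j \<and> x $ j \<le> hi $ j" by auto
      have "x = p + (x $ i - p $ i) *\<^sub>R axis i 1"
        unfolding vec_eq_iff
      proof
        fix j show "x $ j = (p + (x $ i - p $ i) *\<^sub>R axis i 1) $ j"
          using x[of j] by (cases "j = i") (auto simp: lo_def hi_def)
      qed
      then show "x \<in> (\<lambda>s. p + s *\<^sub>R axis i 1) ` {a..b}"
        using x[of i] by (intro image_eqI[of _ _ "x $ i - p $ i"]) (auto simp: lo_def hi_def)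
    qed (use ab in \<open>auto simp: lo_def hi_def\<close>)
    finally show ?thesis using ab by (simp add: axis_segment_eq)
  qed
  moreover have "finite \<H>" by (simp add: \<H>_def)
  moreover have "p + a *\<^sub>R axis i 1 \<noteq> p + b *\<^sub>R axis i 1"
    using ab by (simp add: axis_eq_0_iff)
  ultimately show ?thesis unfolding F_rational_segment_def F_rational_polyhedral_def by blast
qed

text \<open>A functional that attains the maximum at \<open>q\<close> lies below \<open>f\<close>
  along the segment, so its coefficient in direction \<open>i\<close> is an integer
  subgradient.\<close>

lemma integer_subgradients_if_polyhedral:
  fixes S :: "(real ^ 'n) set"
  assumes F: "real_subfield F" and S: "open S" "convex S"
    and poly: "\<And>L. F_rational_segment F L \<Longrightarrow> L \<subseteq> S \<Longrightarrow> parallel_to_axis L \<Longrightarrow>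
           F_integral_polyhedral_on F (L \<inter> F_points F) f"
  shows "integer_subgradients F S f"
proof -
  have support: "\<exists>l. F_integral_affine F l \<and> f q = l q
      \<and> (\<forall>s\<in>F. a \<le> s \<and> s \<le> b \<longrightarrow> l (q + s *\<^sub>R axis i 1) \<le> f (q + s *\<^sub>R axis i 1))"
    if q: "q \<in> F_points F" and ab: "a \<in> F" "b \<in> F" "a \<le> 0" "0 \<le> b" "a < b"
      and in_S: "q + a *\<^sub>R axis i 1 \<in> S" "q + b *\<^sub>R axis i 1 \<in> S" for q i a b
  proof -
    let ?L = "closed_segment (q + a *\<^sub>R axis i 1) (q + b *\<^sub>R axis i 1)"
    have L: "?L = (\<lambda>s. q + s *\<^sub>R axis i 1) ` {a..b}" using ab by (simp add: axis_segment_eq)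
    have "parallel_to_axis ?L"
      unfolding parallel_to_axis_def L by (intro exI[of _ q] exI[of _ i]) (auto simp: axis_line_def)
    then have "F_integral_polyhedral_on F (?L \<inter> F_points F) f"
      using poly F_rational_axis_segment[OF F q ab(1,2,5)] closed_segment_subset[OF in_S S(2)] by blast
    then obtain ls where ls: "ls \<noteq> []" "\<forall>l\<in>set ls. F_integral_affine F l"
      "\<forall>x\<in>?L \<inter> F_points F. f x = Max ((\<lambda>l. l x) ` set ls)"
      by (auto simp: F_integral_polyhedral_on_def)
    have val: "f (q + s *\<^sub>R axis i 1) = Max ((\<lambda>l. l (q + s *\<^sub>R axis i 1)) ` set ls)"
      if "s \<in> F" "a \<le> s" "s \<le> b" for s
      using ls(3) that F_points_shift[OF F q that(1)] by (auto simp: L)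
    have "f q = Max ((\<lambda>l. l q) ` set ls)"
      using val[of 0] F ab by (simp add: real_subfield_def)
    also have "\<dots> \<in> (\<lambda>l. l q) ` set ls" using ls(1) by (intro Max_in) auto
    finally obtain l where l: "l \<in> set ls" "f q = l q" by auto
    have "l (q + s *\<^sub>R axis i 1) \<le> f (q + s *\<^sub>R axis i 1)" if "s \<in> F" "a \<le> s" "s \<le> b" for s
      unfolding val[OF that] using l(1) by (intro Max_ge) auto
    then show ?thesis using l ls(2) by blast
  qed
  show ?thesis
  proof
    fix q assume q: "q \<in> S" "q \<in> F_points F"
    \<comment> \<open>Segments are nondegenerate, so the value at \<open>q\<close> is read off on a
      short one that starts at \<open>q\<close>.\<close>
    obtain d where d: "d > 0" "ball q d \<subseteq> S" using S q openE by metis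
    then obtain h where h: "h \<in> \<rat>" "0 < h" "h < d" using Rats_dense_in_real[of 0 d] by auto
    fix i :: 'n
    have "q + h *\<^sub>R axis i 1 \<in> S" using h d by (auto simp: dist_norm)
    moreover have "0 \<in> F" using F by (simp add: real_subfield_def)
    ultimately obtain l where "F_integral_affine F l" "f q = l q"
      using support[of q 0 h i] q h real_subfield_Rats[OF F] by auto
    then show "f q \<in> F" using F_integral_affine_in_F[OF F _ q(2)] by simp
  next
    fix q i and a b :: real
    assume "q \<in> F_points F" "a \<in> F" "b \<in> F" "a \<le> 0" "0 \<le> b" "a < b"
      "q + a *\<^sub>R axis i 1 \<in> S" "q + b *\<^sub>R axis i 1 \<in> S"
    from support[OF this] obtain l where l: "F_integral_affine F l" "f q = l q"
      "\<And>s. s \<in> F \<Longrightarrow> a \<le> s \<and> s \<le> b \<Longrightarrow> l (q + s *\<^sub>R axis i 1) \<le> f (q + s *\<^sub>R axis i 1)"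
      by blast
    then obtain m c where m: "\<forall>i. m $ i \<in> \<int>" "l = (\<lambda>x. m \<bullet> x + c)"
      by (auto simp: F_integral_affine_def)
    have "f q + m $ i * s \<le> f (q + s *\<^sub>R axis i 1)" if "s \<in> F" "a \<le> s \<and> s \<le> b" for s
      using l(3)[OF that] by (simp add: l(2) m(2) inner_add_right inner_axis algebra_simps)
    then show "\<exists>m\<in>\<int>. \<forall>s\<in>F. a \<le> s \<and> s \<le> b \<longrightarrow> f q + m * s \<le> f (q + s *\<^sub>R axis i 1)"
      using m(1) by blast
  qed (use F S in auto)
qed

theorem theorem6p1:
  fixes F :: "real set" and S :: "(real ^ 'n) set" and f :: "real ^ 'n \<Rightarrow> real"
  assumes "real_subfield F"
    and "open S" and "convex S"
    and "continuous_on (S \<inter> F_points F) f"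
    and "\<And>L. F_rational_segment F L \<Longrightarrow> L \<subseteq> S \<Longrightarrow> parallel_to_axis L \<Longrightarrow>
           F_integral_polyhedral_on F (L \<inter> F_points F) f"
  shows "\<exists>g. axis_convex_extension F S f g \<and>
             (\<forall>h. axis_convex_extension F S f h \<longrightarrow> (\<forall>x\<in>S. h x = g x)) \<and>
             locally_F_integral_polyhedral_on F S g"
proof -
  interpret integer_subgradients F S f
    by (rule integer_subgradients_if_polyhedral) (use assms in auto)
  obtain g where g: "continuous_on S g" "\<And>q. q \<in> S \<Longrightarrow> q \<in> F_points F \<Longrightarrow> g q = f q"
    using continuous_extension_exists by blast
  interpret integer_subgradients_extension F S f g by standard (use g in auto)
  have "axis_convex_extension F S f g"
    using g convex_on_axis_lines by (auto simp: axis_convex_extension_def)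
  \<comment> \<open>Both functions are continuous on \<open>S\<close> and equal \<open>f\<close> on
    the dense subset of points with coordinates in \<open>F\<close>.\<close>
  moreover have "h x = g x" if h: "axis_convex_extension F S f h" and "x \<in> S" for h x
  proof (rule continuous_eq_on_F_points[OF F open_S, where g = h and h = g])
    show "h q = g q" if "q \<in> S" "q \<in> F_points F" for q
      using h g that by (auto simp: axis_convex_extension_def)
  qed (use h g \<open>x \<in> S\<close> in \<open>auto simp: axis_convex_extension_def\<close>)
  ultimately show ?thesis using locally_polyhedral by blast
qed

end
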